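(* $\mathrm{ex}^{(3)}_3(12;P)=32$ and $\mathrm{Ex}^{(3)}_3(12;P)=\{\mathrm{Co}(12)\}$. Equivalently: every 12-vertex $P$-free 3-graph that is contained neither in a full star $S^3_{12}$ nor in a copy of $K^3_6\cup K^3_6$ has at most 32 edges, with equality only for the comet $\mathrm{Co}(12)$.
   Context: All hypergraphs are 3-uniform (3-graphs); containment means containing an isomorphic copy as a sub-3-graph. $P$ is the loose 3-uniform path of length 3: vertices $a,b,c,d,e,f,g$, edges $\{a,b,c\},\{c,d,e\},\{e,f,g\}$. $K^3_m$ is the complete 3-graph on $m$ vertices, $\cup$ denotes vertex-disjoint union. $S^3_n$ is the full star on $n$ vertices (all $\binom{n-1}{2}$ triples containing a fixed center). The comet $\mathrm{Co}(n)$ is the $n$-vertex 3-graph with vertex set $\{c,h_1,h_2,h_3\}\cup R$, $|R|=n-4$, whose edges are the four triples of $\{c,h_1,h_2,h_3\}$ together with all triples $\{c,u,v\}$, $u,v\in R$; it has $4+\binom{n-4}{2}$ edges. Turán numbers of order $s$: $\mathrm{ex}^{(1)}_3(n;P)$ is the maximum number of edges of an $n$-vertex $P$-free 3-graph and $\mathrm{Ex}^{(1)}_3(n;P)$ the family of extremal ones; $\mathrm{ex}^{(s+1)}_3(n;P)$ is the maximum number of edges of an $n$-vertex $P$-free 3-graph not contained in any member of $\mathrm{Ex}^{(1)}_3(n;P)\cup\dots\cup\mathrm{Ex}^{(s)}_3(n;P)$, and $\mathrm{Ex}^{(s+1)}_3(n;P)$ is the family of those attaining it. For $n=12$: $\mathrm{Ex}^{(1)}_3(12;P)=\{S^3_{12}\}$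 and $\mathrm{Ex}^{(2)}_3(12;P)=\{K^3_6\cup K^3_6\}$. *)

theory Defs
  imports Main
begin

definition is_3graph :: "'a set \<Rightarrow> 'a set set \<Rightarrow> bool" where
  "is_3graph V E \<longleftrightarrow> finite V \<and> (\<forall>e\<in>E. e \<subseteq> V \<and> card e = 3)"

definition contains_P :: "'a set set \<Rightarrow> bool" where
  "contains_P E \<longleftrightarrow> (\<exists>a b c d e f g. distinct [a,b,c,d,e,f,g] \<and>
      {a,b,c} \<in> E \<and> {c,d,e} \<in> E \<and> {e,f,g} \<in> E)"

definition sub_iso :: "'a set \<Rightarrow> 'a set set \<Rightarrow> 'b set \<Rightarrow> 'b set set \<Rightarrow> bool" where
  "sub_iso V E V' E' \<longleftrightarrow> (\<exists>f. inj_on f V \<and> f ` V \<subseteq> V' \<and> (\<forall>e\<in>E. f ` e \<in> E'))"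

definition iso3 :: "'a set \<Rightarrow> 'a set set \<Rightarrow> 'b set \<Rightarrow> 'b set set \<Rightarrow> bool" where
  "iso3 V E V' E' \<longleftrightarrow> (\<exists>f. bij_betw f V V' \<and> (\<forall>e. e \<subseteq> V \<longrightarrow> (e \<in> E \<longleftrightarrow> f ` e \<in> E')))"

definition triples :: "'a set \<Rightarrow> 'a set set" where
  "triples S = {e. e \<subseteq> S \<and> card e = 3}"

definition star_E :: "nat \<Rightarrow> nat set set" where
  "star_E n = {e \<in> triples {0..<n}. 0 \<in> e}"

definition K6K6_E :: "nat set set" where
  "K6K6_E = triples {0..<6} \<union> triples {6..<12}"

text \<open>Comet Co(n): centre c = 0, head vertices h1,h2,h3 = 1,2,3, R = {4..<n}.\<close>
definition comet_E :: "nat \<Rightarrow> nat set set" where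
  "comet_E n = triples {0..<4} \<union> {{0,u,v} | u v. u \<in> {4..<n} \<and> v \<in> {4..<n} \<and> u \<noteq> v}"

end

theory Submission
  imports Defs Complex_Main
begin

text \<open>
  Let \<open>E\<close> be \<open>P\<close>-free on 12 vertices with at least 32 edges.

  If \<open>E\<close> contains a loose triangle on a 6-set \<open>U\<close>, an edge crossing \<open>U\<close> adds one outside vertex to
  two core vertices or to a core vertex and its opposite. Suppose \<open>k > 0\<close> outside vertices lie on
  crossing edges. They lie on no edge disjoint from \<open>U\<close>, so those number at most \<open>binom(6-k, 3)\<close>;
  there are at most \<open>3 max(k, 2)\<close> crossing edges; and a crossing edge forbids complementary triples
  in \<open>U\<close>, leaving at most 13 there. The total is at most 31, so \<open>k = 0\<close> and
  \<open>E\<close> lies in two disjoint copies of \<open>K_6\<close>.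

  Otherwise \<open>E\<close> has no loose triangle. If \<open>p, q\<close> are disjoint edges of the link of \<open>x\<close> and an edge
  \<open>g\<close> avoiding \<open>x\<close> meets \<open>p\<close> in one vertex, then \<open>q \<subseteq> g\<close>. Hence, if the link of some \<open>x\<close> has a
  matching of size 3, every edge avoiding \<open>x\<close> is a union of components of that link, and counting
  leaves only the star and the comet. If no link has such a matching, the edges are classified by
  their trace on two edges meeting in a single vertex, and there are at most 31 of them.
\<close>

section \<open>Preliminaries\<close>

lemma card3_with:
  assumes "card e = 3" "c \<in> e"
  obtains a b where "e = {a,b,c}" "a \<noteq> b" "a \<noteq> c" "b \<noteq> c"
proof -
  have "card (e - {c}) = 2" using assms by simp
  then obtain a b where "e - {c} = {a,b}" "a \<noteq> b" by (auto simp: card_2_iff)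
  with assms that[of a b] show ?thesis by (metis Diff_iff insertI1 insertCI insert_Diff insert_commute)
qed

lemma card3_with2:
  assumes "card e = 3" "c \<in> e" "d \<in> e" "c \<noteq> d"
  obtains a where "e = {a,c,d}" "a \<noteq> c" "a \<noteq> d"
proof -
  obtain a b where "e = {a,b,c}" "a \<noteq> b" "a \<noteq> c" "b \<noteq> c" using card3_with[OF assms(1,2)] .
  with assms(3,4) that[of a] that[of b] show ?thesis by (auto simp: insert_commute)
qed

lemma finite_triples: "finite S \<Longrightarrow> finite (triples S)"
  by (auto simp: triples_def)

lemma card_triples: "finite S \<Longrightarrow> card (triples S) = card S choose 3"
  by (simp add: triples_def n_subsets)

lemma card_Un3_le: "card (A \<union> B \<union> C) \<le> card A + card B + card C"
  using card_Un_le[of "A \<union> B" C] card_Un_le[of A B] by linarith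

text \<open>Unless one of the two sets is empty, both are the same singleton; this case contributes
  the 2 in the maximum.\<close>

lemma card_pairs_agree:
  assumes "finite K" "A \<subseteq> K" "B \<subseteq> K" "\<And>a b. a \<in> A \<Longrightarrow> b \<in> B \<Longrightarrow> a = b"
  shows "card A + card B \<le> max (card K) 2"
proof (cases "A = {} \<or> B = {}")
  case True
  then show ?thesis using card_mono[OF assms(1,2)] card_mono[OF assms(1,3)] by auto
next
  case False
  then obtain a b where "a \<in> A" "b \<in> B" by auto
  then have "A = {a}" "B = {a}" using assms(4) by blast+
  then show ?thesis by simp
qed

text \<open>Counts the incidences between \<open>G\<close> and \<open>J\<close> from both
  sides.\<close>

lemma double_count_le:
  assumes "finite G" "finite J" "\<And>g. g \<in> G \<Longrightarrow> k \<le> card (g \<inter> J)"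
    "\<And>v. v \<in> J \<Longrightarrow> card {g \<in> G. v \<in> g} \<le> c"
  shows "k * card G \<le> c * card J"
proof -
  have "k * card G = (\<Sum>g\<in>G. k)" by simp
  also have "\<dots> \<le> (\<Sum>g\<in>G. card {v \<in> J. v \<in> g})"
    by (rule sum_mono) (use assms(3) in \<open>simp add: Int_def conj_commute\<close>)
  also have "\<dots> = (\<Sum>v\<in>J. card {g \<in> G. v \<in> g})"
    by (rule sum_multicount_gen[symmetric]) (use assms in auto)
  also have "\<dots> \<le> (\<Sum>v\<in>J. c)" by (rule sum_mono) (use assms(4) in simp)
  finally show ?thesis by (simp add: mult.commute)
qed

section \<open>3-graphs without a loose path of length three\<close>

locale P_free_3graph =
  fixes V :: "'a set" and E :: "'a set set"
  assumes graph: "is_3graph V E" and P_free: "\<not> contains_P E"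
begin

lemma fin_V: "finite V" and edge_sub: "e \<in> E \<Longrightarrow> e \<subseteq> V" and edge_card: "e \<in> E \<Longrightarrow> card e = 3"
  using graph by (auto simp: is_3graph_def)

lemma fin_E: "finite E"
  using fin_V edge_sub by (meson Pow_iff finite_Pow_iff rev_finite_subset subsetI)

lemma edge_finite: "e \<in> E \<Longrightarrow> finite e"
  using edge_card by (metis card.infinite zero_neq_numeral)

lemma no_path:
  "\<lbrakk>{a,b,c} \<in> E; {c,d,e} \<in> E; {e,f,g} \<in> E; distinct [a,b,c,d,e,f,g]\<rbrakk> \<Longrightarrow> False"
  using P_free unfolding contains_P_def by blast

text \<open>Since the end edges \<open>e\<close> and \<open>g\<close> are disjoint, the two
  attaching vertices on \<open>f\<close> differ, so seven distinct vertices of a path can be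
  named.\<close>

lemma no_path_sets:
  assumes "e \<in> E" "f \<in> E" "g \<in> E" "card (e \<inter> f) = 1" "card (f \<inter> g) = 1" "e \<inter> g = {}"
  shows False
proof -
  obtain c where c: "e \<inter> f = {c}" using assms(4) card_1_singletonE by blast
  obtain h where h: "f \<inter> g = {h}" using assms(5) card_1_singletonE by blast
  have "c \<noteq> h" using c h assms(6) by blast
  obtain a b where ab: "e = {a,b,c}" "a \<noteq> b" "a \<noteq> c" "b \<noteq> c"
    using card3_with[of e c] edge_card assms(1) c by blast
  obtain i j where ij: "g = {i,j,h}" "i \<noteq> j" "i \<noteq> h" "j \<noteq> h"
    using card3_with[of g h] edge_card assms(3) h by blast
  obtain d where d: "f = {d,c,h}" "d \<noteq> c" "d \<noteq> h"
    using card3_with2[of f c h] edge_card assms(2) c h \<open>c \<noteq> h\<close> by blast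
  have "a \<notin> f" "b \<notin> f" "i \<notin> f" "j \<notin> f" "{a,b,c} \<inter> {i,j,h} = {}"
    using ab ij c h assms(6) by blast+
  then have "distinct [a,b,c,d,h,i,j]"
    using ab(2-) ij(2-) d \<open>c \<noteq> h\<close> by auto
  moreover have "{a,b,c} \<in> E" "{c,d,h} \<in> E" "{h,i,j} \<in> E"
    using assms(1-3) ab(1) ij(1) d(1) by (simp_all add: insert_commute)
  ultimately show False using no_path by blast
qed

end

section \<open>Loose triangles\<close>

text \<open>The core is \<open>x1\<close>, \<open>x2\<close>, \<open>x3\<close>. Indices are chosen
  so that \<open>yi\<close> lies on the triangle edge avoiding \<open>xi\<close>; these two vertices
  are called opposite.\<close>

locale P_free_with_triangle = P_free_3graph +
  fixes x1 x2 x3 y1 y2 y3 :: 'a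
  assumes dist: "distinct [x1,x2,x3,y1,y2,y3]"
    and t3: "{x1,x2,y3} \<in> E" and t1: "{x2,x3,y1} \<in> E" and t2: "{x1,x3,y2} \<in> E"
begin

definition U :: "'a set" where "U = {x1,x2,x3,y1,y2,y3}"

lemma U_sub: "U \<subseteq> V"
  using edge_sub[OF t1] edge_sub[OF t2] edge_sub[OF t3] by (simp add: U_def)

lemma fin_U: "finite U" and card_U: "card U = 6"
  using dist by (simp_all add: U_def)

text \<open>Each vertex of \<open>U\<close> starts a two-edge loose path inside the triangle, whose
  second edge avoids it; \<open>{w,w',u}\<close> would prolong this path to
  \<open>P\<close>.\<close>

lemma one_vertex_in_U:
  assumes "w \<notin> U" "w' \<notin> U" "w \<noteq> w'" "u \<in> U"
  shows "{w,w',u} \<notin> E"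
proof
  assume e: "{w,w',u} \<in> E"
  consider "u = x1" | "u = x2" | "u = x3" | "u = y1" | "u = y2" | "u = y3"
    using assms(4) by (auto simp: U_def)
  then show False
  proof cases
    case 1 then show ?thesis
      using no_path[of w w' x1 y3 x2 x3 y1] e t1 t2 t3 dist assms by (auto simp: insert_commute U_def)
  next
    case 2 then show ?thesis
      using no_path[of w w' x2 y3 x1 x3 y2] e t1 t2 t3 dist assms by (auto simp: insert_commute U_def)
  next
    case 3 then show ?thesis
      using no_path[of w w' x3 y2 x1 x2 y3] e t1 t2 t3 dist assms by (auto simp: insert_commute U_def)
  next
    case 4 then show ?thesis
      using no_path[of w w' y1 x3 x2 x1 y3] e t1 t2 t3 dist assms by (auto simp: insert_commute U_def)
  next
    case 5 then show ?thesis
      using no_path[of w w' y2 x3 x1 x2 y3] e t1 t2 t3 dist assms by (auto simp: insert_commute U_def)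
  next
    case 6 then show ?thesis
      using no_path[of w w' y3 x2 x1 x3 y2] e t1 t2 t3 dist assms by (auto simp: insert_commute U_def)
  qed
qed

text \<open>The nine pairs of \<open>U\<close> that miss some triangle edge are excluded here.
  Another triangle edge meets the pair in one vertex, and the crossing edge followed by these two
  edges is a copy of \<open>P\<close>.\<close>

lemma no_crossing:
  assumes "w \<notin> U"
  shows "{w,y1,y2} \<notin> E"
    "{w,y1,y3} \<notin> E"
    "{w,y2,y3} \<notin> E"
    "{w,x1,y2} \<notin> E"
    "{w,x1,y3} \<notin> E"
    "{w,x2,y1} \<notin> E"
    "{w,x2,y3} \<notin> E"
    "{w,x3,y1} \<notin> E"
    "{w,x3,y2} \<notin> E"
proof -
  have d: "distinct [w,x1,x2,x3,y1,y2,y3]" using assms dist by (auto simp: U_def)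
  show "{w,y1,y2} \<notin> E"
    using no_path[of w y2 y1 x3 x2 x1 y3] t1 t2 t3 d by (auto simp: insert_commute)
  show "{w,y1,y3} \<notin> E"
    using no_path[of w y3 y1 x2 x3 x1 y2] t1 t2 t3 d by (auto simp: insert_commute)
  show "{w,y2,y3} \<notin> E"
    using no_path[of w y3 y2 x1 x3 x2 y1] t1 t2 t3 d by (auto simp: insert_commute)
  show "{w,x1,y2} \<notin> E"
    using no_path[of w y2 x1 y3 x2 x3 y1] t1 t2 t3 d by (auto simp: insert_commute)
  show "{w,x1,y3} \<notin> E"
    using no_path[of w y3 x1 y2 x3 x2 y1] t1 t2 t3 d by (auto simp: insert_commute)
  show "{w,x2,y1} \<notin> E"
    using no_path[of w y1 x2 y3 x1 x3 y2] t1 t2 t3 d by (auto simp: insert_commute)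
  show "{w,x2,y3} \<notin> E"
    using no_path[of w y3 x2 y1 x3 x1 y2] t1 t2 t3 d by (auto simp: insert_commute)
  show "{w,x3,y1} \<notin> E"
    using no_path[of w y1 x3 y2 x1 x2 y3] t1 t2 t3 d by (auto simp: insert_commute)
  show "{w,x3,y2} \<notin> E"
    using no_path[of w y2 x3 y1 x2 x1 y3] t1 t2 t3 d by (auto simp: insert_commute)
qed

text \<open>These are the two-element transversals of the triangle: the pairs of \<open>U\<close>
  meeting all three of its edges.\<close>

definition pairs :: "'a set set" where
  "pairs = {{x1,x2},{x1,x3},{x2,x3},{x1,y1},{x2,y2},{x3,y3}}"

lemma crossing_form:
  assumes "e \<in> E" "e \<inter> U \<noteq> {}" "\<not> e \<subseteq> U"
  obtains w p where "w \<in> V - U" "p \<in> pairs" "e = insert w p"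
proof -
  obtain w u where wu: "w \<in> e" "w \<notin> U" "u \<in> e" "u \<in> U" using assms by blast
  then obtain v where v: "e = {v,w,u}" "v \<noteq> w" "v \<noteq> u"
    using card3_with2[of e w u] edge_card assms(1) by blast
  have "v \<in> U" using one_vertex_in_U[of v w u] wu v assms(1) by blast
  have ee: "e = insert w {u,v}" using v by auto
  have "{u,v} \<in> pairs"
    using \<open>v \<in> U\<close> wu(4) no_crossing[OF wu(2)] assms(1) v(3) unfolding ee U_def pairs_def
    by (elim insertE emptyE) (simp_all add: insert_commute)
  then show ?thesis using that ee wu assms(1) edge_sub by blast
qed

text \<open>Supplies an edge by which a path coming through a crossing edge continues inside
  \<open>U\<close>.\<close>

lemma pairs_attach:
  assumes "p \<in> pairs"
  obtains t where "t \<in> E" "t \<subseteq> U" "card (p \<inter> t) = 1"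
proof -
  have "card (p \<inter> {x1,x3,y2}) = 1 \<or> card (p \<inter> {x1,x2,y3}) = 1 \<or> card (p \<inter> {x2,x3,y1}) = 1"
    using assms dist unfolding pairs_def by (elim insertE emptyE) (simp_all add: insert_commute)
  moreover have "{x1,x3,y2} \<subseteq> U" "{x1,x2,y3} \<subseteq> U" "{x2,x3,y1} \<subseteq> U" by (auto simp: U_def)
  ultimately show ?thesis using that t1 t2 t3 by blast
qed

lemma pairs_sub: "p \<in> pairs \<Longrightarrow> p \<subseteq> U" and pairs_card: "p \<in> pairs \<Longrightarrow> card p = 2"
  using dist by (auto simp: pairs_def U_def)

text \<open>Otherwise \<open>g\<close>, the crossing edge and a triangle edge meeting
  \<open>p\<close> in one vertex form a path.\<close>

lemma crossing_outside:
  assumes "p \<in> pairs" "w \<in> V - U" "insert w p \<in> E" "g \<in> E" "g \<inter> U = {}"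
  shows "w \<notin> g"
proof
  assume "w \<in> g"
  obtain t where t: "t \<in> E" "t \<subseteq> U" "card (p \<inter> t) = 1" using pairs_attach[OF assms(1)] .
  have "g \<inter> insert w p = {w}" using \<open>w \<in> g\<close> assms pairs_sub by blast
  moreover have "insert w p \<inter> t = p \<inter> t" using assms t by blast
  moreover have "g \<inter> t = {}" using assms t by blast
  ultimately show False using no_path_sets[of g "insert w p" t] t assms by simp
qed

text \<open>The two pairs are disjoint and some triangle edge meets each of them in one vertex, so
  it would join the two crossing edges to a path.\<close>

lemma crossing_conflict:
  assumes "w \<in> V - U" "w' \<in> V - U" "w \<noteq> w'"
  shows "{w,x1,x2} \<in> E \<Longrightarrow> {w',x3,y3} \<notin> E"
    "{w,x1,x3} \<in> E \<Longrightarrow> {w',x2,y2} \<notin> E"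
    "{w,x2,x3} \<in> E \<Longrightarrow> {w',x1,y1} \<notin> E"
proof -
  have d: "distinct [w,w',x1,x2,x3,y1,y2,y3]" using assms dist by (auto simp: U_def)
  show "{w',x3,y3} \<notin> E" if "{w,x1,x2} \<in> E"
    using no_path[of w x2 x1 y2 x3 y3 w'] that t1 t2 t3 d by (auto simp: insert_commute)
  show "{w',x2,y2} \<notin> E" if "{w,x1,x3} \<in> E"
    using no_path[of w x3 x1 y3 x2 y2 w'] that t1 t2 t3 d by (auto simp: insert_commute)
  show "{w',x1,y1} \<notin> E" if "{w,x2,x3} \<in> E"
    using no_path[of w x3 x2 y3 x1 y1 w'] that t1 t2 t3 d by (auto simp: insert_commute)
qed

section \<open>Counting edges around a loose triangle\<close>

definition attach :: "'a set \<Rightarrow> 'a set" where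
  "attach p = {w \<in> V - U. insert w p \<in> E}"

definition W1 :: "'a set" where "W1 = (\<Union>p\<in>pairs. attach p)"

lemma W1_sub: "W1 \<subseteq> V - U" and fin_W1: "finite W1"
  using fin_V by (auto simp: W1_def attach_def pairs_def)

lemma attach_sub: "p \<in> pairs \<Longrightarrow> attach p \<subseteq> W1" by (auto simp: W1_def)

definition crossing :: "'a set set" where
  "crossing = {e \<in> E. e \<inter> U \<noteq> {} \<and> \<not> e \<subseteq> U}"

text \<open>The six transversals form three couples \<open>{xi,xj}\<close>, \<open>{xk,yk}\<close>.
  By \<open>crossing_conflict\<close> the vertices attached to the two pairs of a couple agree, so
  \<open>card_pairs_agree\<close> bounds each couple by \<open>max (card W1) 2\<close>.\<close>

lemma card_crossing: "card crossing \<le> 3 * max (card W1) 2"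
proof -
  have fin: "finite (attach p)" for p using fin_V by (simp add: attach_def)
  have pp: "{x1,x2} \<in> pairs" "{x1,x3} \<in> pairs" "{x2,x3} \<in> pairs"
    "{x1,y1} \<in> pairs" "{x2,y2} \<in> pairs" "{x3,y3} \<in> pairs" by (auto simp: pairs_def)
  have "crossing \<subseteq> (\<Union>p\<in>pairs. (\<lambda>w. insert w p) ` attach p)"
  proof
    fix e assume e: "e \<in> crossing"
    then obtain w p where "w \<in> V - U" "p \<in> pairs" "e = insert w p"
      using crossing_form[of e] unfolding crossing_def by blast
    with e show "e \<in> (\<Union>p\<in>pairs. (\<lambda>w. insert w p) ` attach p)"
      by (auto simp: attach_def crossing_def)
  qed
  then have "card crossing \<le> card (\<Union>p\<in>pairs. (\<lambda>w. insert w p) ` attach p)"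
    by (rule card_mono[rotated]) (auto simp: fin pairs_def)
  also have "\<dots> \<le> (\<Sum>p\<in>pairs. card ((\<lambda>w. insert w p) ` attach p))"
    by (rule card_UN_le) (simp add: pairs_def)
  also have "\<dots> \<le> (\<Sum>p\<in>pairs. card (attach p))"
    by (rule sum_mono) (rule card_image_le[OF fin])
  also have "\<dots> = (card (attach {x1,x2}) + card (attach {x3,y3})) + (card (attach {x1,x3}) + card (attach {x2,y2}))
      + (card (attach {x2,x3}) + card (attach {x1,y1}))"
    unfolding pairs_def using dist by (simp add: doubleton_eq_iff)
  also have "\<dots> \<le> max (card W1) 2 + max (card W1) 2 + max (card W1) 2"
  proof -
    have "card (attach {x1,x2}) + card (attach {x3,y3}) \<le> max (card W1) 2"
      by (intro card_pairs_agree fin_W1 attach_sub pp) (auto simp: attach_def dest: crossing_conflict[rotated 3])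
    moreover have "card (attach {x1,x3}) + card (attach {x2,y2}) \<le> max (card W1) 2"
      by (intro card_pairs_agree fin_W1 attach_sub pp) (auto simp: attach_def dest: crossing_conflict[rotated 3])
    moreover have "card (attach {x2,x3}) + card (attach {x1,y1}) \<le> max (card W1) 2"
      by (intro card_pairs_agree fin_W1 attach_sub pp) (auto simp: attach_def dest: crossing_conflict[rotated 3])
    ultimately show ?thesis by linarith
  qed
  finally show ?thesis by simp
qed

text \<open>In each case a triangle edge meets \<open>p\<close> in one vertex and the chosen triple
  in one vertex. If the triple were an edge, the crossing edge and these two would form a
  path.\<close>

lemma U_triple_missing:
  assumes "p \<in> pairs" "w \<in> V - U" "insert w p \<in> E"
  obtains t where "t \<subseteq> U - p" "card t = 3" "t \<notin> E"
proof -
  have d: "w \<notin> U" using assms by auto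
  have "\<exists>t. t \<subseteq> U - p \<and> card t = 3 \<and> t \<notin> E"
    using assms(1) unfolding pairs_def
  proof (elim insertE emptyE)
    assume p: "p = {x1,x2}" show ?thesis
      using no_path[of w x2 x1 x3 y2 y1 y3] p assms d t1 t2 t3 dist
      by (intro exI[of _ "{y1,y2,y3}"]) (auto simp: insert_commute U_def)
  next
    assume p: "p = {x1,x3}" show ?thesis
      using no_path[of w x3 x1 x2 y3 y1 y2] p assms d t1 t2 t3 dist
      by (intro exI[of _ "{y1,y2,y3}"]) (auto simp: insert_commute U_def)
  next
    assume p: "p = {x2,x3}" show ?thesis
      using no_path[of w x3 x2 x1 y3 y1 y2] p assms d t1 t2 t3 dist
      by (intro exI[of _ "{y1,y2,y3}"]) (auto simp: insert_commute U_def)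
  next
    assume p: "p = {x1,y1}" show ?thesis
      using no_path[of w y1 x1 y3 x2 x3 y2] p assms d t1 t2 t3 dist
      by (intro exI[of _ "{x2,x3,y2}"]) (auto simp: insert_commute U_def)
  next
    assume p: "p = {x2,y2}" show ?thesis
      using no_path[of w y2 x2 y3 x1 x3 y1] p assms d t1 t2 t3 dist
      by (intro exI[of _ "{x1,x3,y1}"]) (auto simp: insert_commute U_def)
  next
    assume p: "p = {x3,y3}" show ?thesis
      using no_path[of w y3 x3 y2 x1 x2 y1] p assms d t1 t2 t3 dist
      by (intro exI[of _ "{x1,x2,y1}"]) (auto simp: insert_commute U_def)
  qed
  then show ?thesis using that by blast
qed

text \<open>The 20 triples of \<open>U\<close> are sorted by their trace on \<open>p\<close>. The 12
  that separate \<open>a\<close> from \<open>b\<close> form 6 complementary couples with at most one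
  edge each; 4 contain \<open>p\<close>; of the 4 disjoint from \<open>p\<close> one is missing.
  This gives 6 + 4 + 3.\<close>

lemma card_inside_U:
  assumes "p \<in> pairs" "w \<in> V - U" "insert w p \<in> E"
  shows "card {e \<in> E. e \<subseteq> U} \<le> 13"
proof -
  obtain a b where ab: "p = {a,b}" "a \<noteq> b" using pairs_card[OF assms(1)] by (auto simp: card_2_iff)
  have abU: "a \<in> U" "b \<in> U" using ab pairs_sub assms by auto
  let ?R = "U - p"
  have R: "finite ?R" "card ?R = 4"
    using fin_U card_U abU ab by (auto simp: card_Diff_subset)
  have Ue: "U = insert a (insert b ?R)" using abU ab by auto
  define F where "F = {e \<in> E. e \<subseteq> U}"
  have finF: "finite F" using fin_E by (simp add: F_def)
  define X where "X = {e \<in> F. a \<in> e \<and> b \<notin> e}"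
  define Y where "Y = {e \<in> F. b \<in> e \<and> a \<notin> e}"
  define Z where "Z = {e \<in> F. a \<in> e \<and> b \<in> e}"
  define N where "N = {e \<in> F. a \<notin> e \<and> b \<notin> e}"
  \<comment> \<open>\<open>D\<close> has one member from each complementary couple; complementation
    in \<open>U\<close> carries \<open>Y\<close> into it, away from \<open>X\<close>.\<close>
  define D where "D = insert a ` {q. q \<subseteq> ?R \<and> card q = 2}"
  have "card D = card {q. q \<subseteq> ?R \<and> card q = 2}"
    unfolding D_def by (rule card_image) (use ab in \<open>auto simp: inj_on_def insert_eq_iff\<close>)
  then have cD: "card D = 6" using n_subsets[OF R(1), of 2] R(2) by (simp add: choose_two)
  have finD: "finite D" using R(1) by (simp add: D_def)
  have inD: "e \<in> D" if "e \<subseteq> U" "card e = 3" "a \<in> e" "b \<notin> e" for e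
  proof -
    have "finite e" using that fin_U finite_subset by blast
    then have "e = insert a (e - {a})" "e - {a} \<subseteq> ?R" "card (e - {a}) = 2"
      using that ab by auto
    then show ?thesis unfolding D_def by blast
  qed
  have XD: "X \<subseteq> D" using inD edge_card by (auto simp: X_def F_def)
  \<comment> \<open>\<open>insert w p\<close> would join two complementary triples separating \<open>a\<close> and \<open>b\<close> to a path.\<close>
  have YD: "(\<lambda>e. U - e) ` Y \<subseteq> D - X"
  proof (rule image_subsetI)
    fix e assume e: "e \<in> Y"
    then have e': "e \<in> E" "e \<subseteq> U" "b \<in> e" "a \<notin> e" "card e = 3" by (auto simp: Y_def F_def edge_card)
    have "card (U - e) = 3" using e' card_U edge_finite by (simp add: card_Diff_subset)
    then have "U - e \<in> D" using inD e' abU by auto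
    moreover have "U - e \<notin> X"
    proof
      assume "U - e \<in> X"
      then have f: "U - e \<in> E" by (auto simp: X_def F_def)
      have "(U - e) \<inter> insert w p = {a}" using e' ab abU assms by auto
      moreover have "insert w p \<inter> e = {b}" using e' ab abU assms by auto
      ultimately show False using no_path_sets[OF f assms(3) e'(1)] by auto
    qed
    ultimately show "U - e \<in> D - X" by simp
  qed
  have "card Y = card ((\<lambda>e. U - e) ` Y)"
    by (rule card_image[symmetric]) (auto simp: inj_on_def Y_def F_def)
  also have "\<dots> \<le> card (D - X)" using YD finD by (intro card_mono) auto
  also have "\<dots> = 6 - card X" using XD finD cD by (simp add: card_Diff_subset finite_subset)
  finally have XY: "card X + card Y \<le> 6" using card_mono[OF finD XD] cD by linarith
  have "Z \<subseteq> (\<lambda>r. {r,a,b}) ` ?R"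
  proof
    fix e assume "e \<in> Z"
    then have e: "e \<in> E" "e \<subseteq> U" "a \<in> e" "b \<in> e" by (auto simp: Z_def F_def)
    then obtain r where "e = {r,a,b}" "r \<noteq> a" "r \<noteq> b"
      using card3_with2[of e a b] edge_card ab(2) by blast
    with e ab show "e \<in> (\<lambda>r. {r,a,b}) ` ?R" by auto
  qed
  then have Z: "card Z \<le> 4" using surj_card_le[OF R(1)] R(2) by fastforce
  obtain t where t: "t \<subseteq> ?R" "card t = 3" "t \<notin> E" using U_triple_missing[OF assms] .
  have "N \<subseteq> triples ?R - {t}" using t edge_card ab by (auto simp: N_def F_def triples_def)
  then have "card N \<le> card (triples ?R - {t})" using finite_triples[OF R(1)] by (intro card_mono) auto
  also have "\<dots> = 3"
    using t R card_triples[OF R(1)] finite_triples[OF R(1)]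
    by (simp add: triples_def numeral_eq_Suc)
  finally have N: "card N \<le> 3" .
  have "F = X \<union> Y \<union> Z \<union> N" by (auto simp: X_def Y_def Z_def N_def)
  then have "card F \<le> card X + card Y + card Z + card N"
    using card_Un3_le[of X Y Z] card_Un_le[of "X \<union> Y \<union> Z" N] by simp
  then show ?thesis using XY Z N unfolding F_def by linarith
qed

lemma triangle_bound:
  assumes "card V = 12"
  shows "card E \<le> 31 \<or> (\<forall>e\<in>E. e \<subseteq> U \<or> e \<subseteq> V - U)"
proof (cases "W1 = {}")
  case True
  have "e \<subseteq> U \<or> e \<subseteq> V - U" if e: "e \<in> E" for e
  proof (rule ccontr)
    assume c: "\<not> ?thesis"
    then obtain w p where "w \<in> V - U" "p \<in> pairs" "e = insert w p"
      using crossing_form[of e] e edge_sub[OF e] by blast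
    then show False using True e by (auto simp: W1_def attach_def)
  qed
  then show ?thesis by blast
next
  case False
  then obtain w p where wp: "p \<in> pairs" "w \<in> V - U" "insert w p \<in> E" by (auto simp: W1_def attach_def)
  have cW: "card (V - U) = 6" using assms card_U U_sub fin_U by (simp add: card_Diff_subset)
  have k: "1 \<le> card W1" "card W1 \<le> 6"
    using False fin_W1 card_mono[OF _ W1_sub] fin_V cW by (auto simp: Suc_le_eq card_gt_0_iff)
  have "{e \<in> E. e \<inter> U = {}} \<subseteq> triples (V - U - W1)"
  proof
    fix e assume e: "e \<in> {e \<in> E. e \<inter> U = {}}"
    have "w \<notin> e" if "w \<in> W1" for w
    proof -
      from that obtain p where "p \<in> pairs" "w \<in> V - U" "insert w p \<in> E"
        by (auto simp: W1_def attach_def)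
      then show ?thesis using e by (intro crossing_outside) auto
    qed
    then have "e \<inter> W1 = {}" by blast
    with e show "e \<in> triples (V - U - W1)" using edge_sub edge_card by (auto simp: triples_def)
  qed
  then have "card {e \<in> E. e \<inter> U = {}} \<le> card (triples (V - U - W1))"
    using fin_V by (intro card_mono finite_triples) auto
  also have "\<dots> = (6 - card W1) choose 3"
    using fin_V card_triples[of "V - U - W1"] W1_sub fin_W1 cW by (simp add: card_Diff_subset)
  finally have out: "card {e \<in> E. e \<inter> U = {}} \<le> (6 - card W1) choose 3" .
  have "E = {e \<in> E. e \<subseteq> U} \<union> crossing \<union> {e \<in> E. e \<inter> U = {}}"
    by (auto simp: crossing_def)
  then have "card E \<le> card {e \<in> E. e \<subseteq> U} + card crossing + card {e \<in> E. e \<inter> U = {}}"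
    using card_Un3_le[of "{e \<in> E. e \<subseteq> U}" crossing "{e \<in> E. e \<inter> U = {}}"] by simp
  also have "\<dots> \<le> 13 + 3 * max (card W1) 2 + ((6 - card W1) choose 3)"
    using card_inside_U[OF wp] card_crossing out by linarith
  \<comment> \<open>For \<open>card W1\<close> from 1 to 6 the sum is 29, 23, 23, 25, 28,
    31.\<close>
  also have "\<dots> \<le> 31"
  proof -
    consider "card W1 = 1" | "card W1 = 2" | "card W1 = 3" | "card W1 = 4" | "card W1 = 5" | "card W1 = 6"
      using k by linarith
    then show ?thesis by cases (simp_all add: numeral_eq_Suc)
  qed
  finally show ?thesis by simp
qed

end

section \<open>Link graphs\<close>

lemma card_le_length: "A \<subseteq> set xs \<Longrightarrow> card A \<le> length xs"
  using card_mono[OF finite_set, of A xs] card_length[of xs] by linarith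

text \<open>Either two of the sets are empty and the third is bounded by \<open>K\<close>, or all
  three lie in a common singleton.\<close>

lemma card_agree3:
  assumes "finite K" "A \<subseteq> K" "B \<subseteq> K" "C \<subseteq> K"
    "\<And>a b. a \<in> A \<Longrightarrow> b \<in> B \<Longrightarrow> a = b"
    "\<And>a c. a \<in> A \<Longrightarrow> c \<in> C \<Longrightarrow> a = c"
    "\<And>b c. b \<in> B \<Longrightarrow> c \<in> C \<Longrightarrow> b = c"
  shows "card A + card B + card C \<le> max (card K) 3"
proof -
  have le: "card A \<le> card K" "card B \<le> card K" "card C \<le> card K"
    using assms(1-4) card_mono by blast+
  have one: "card X \<le> 1" if "X \<subseteq> {a}" for X and a :: 'a
    using card_mono[OF _ that] by simp
  have "A = {} \<and> B = {} \<or> A = {} \<and> C = {} \<or> B = {} \<and> C = {} \<or> (\<exists>a. A \<subseteq> {a} \<and> B \<subseteq> {a} \<and> C \<subseteq> {a})"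
    using assms(5-7) by blast
  then consider "A = {}" "B = {}" | "A = {}" "C = {}" | "B = {}" "C = {}"
    | a where "A \<subseteq> {a}" "B \<subseteq> {a}" "C \<subseteq> {a}" by blast
  then show ?thesis
  proof cases
    case 4
    then show ?thesis using one[of A a] one[of B a] one[of C a] by auto
  qed (use le in auto)
qed

lemma card_eq_1I: "A = {a} \<Longrightarrow> card A = 1"
  by simp

lemma card2_with:
  assumes "card p = 2" "y \<in> p"
  obtains a where "p = {y,a}" "a \<noteq> y"
  using assms by (auto simp: card_2_iff)

text \<open>A pairwise intersecting family of pairs is a star or lies in a triangle, and a triangle
  has only three pairs.\<close>

lemma intersecting_pairs_star:
  assumes "\<And>p. p \<in> L \<Longrightarrow> card p = 2" "\<And>p q. p \<in> L \<Longrightarrow> q \<in> L \<Longrightarrow> p \<inter> q \<noteq> {}" "4 \<le> card L"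
  obtains y where "\<And>p. p \<in> L \<Longrightarrow> y \<in> p"
proof -
  have "L \<noteq> {}" using assms(3) by auto
  then obtain p where p: "p \<in> L" by blast
  have "\<not> L \<subseteq> set [p]" using card_le_length[of L "[p]"] assms(3) by auto
  then obtain q where "q \<in> L" "q \<noteq> p" by auto
  then have pq: "p \<in> L" "q \<in> L" "p \<noteq> q" using p by auto
  obtain y where y: "y \<in> p" "y \<in> q" using assms(2)[OF pq(1,2)] by blast
  obtain a where a: "p = {y,a}" "a \<noteq> y"
    using card2_with[OF assms(1)[OF pq(1)] y(1)] .
  obtain b where b: "q = {y,b}" "b \<noteq> y"
    using card2_with[OF assms(1)[OF pq(2)] y(2)] .
  have ab: "a \<noteq> b" using a b pq by auto
  have "y \<in> r" if r: "r \<in> L" for r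
  proof (rule ccontr)
    assume ny: "y \<notin> r"
    have "a \<in> r" "b \<in> r" using assms(2)[OF r pq(1)] assms(2)[OF r pq(2)] a b ny by auto
    then have rab: "r = {a,b}" using assms(1)[OF r] ab by (auto simp: card_2_iff)
    have "L \<subseteq> set [p,q,r]"
    proof
      fix s assume s: "s \<in> L"
      obtain u v where uv: "s = {u,v}" "u \<noteq> v" using assms(1)[OF s] by (auto simp: card_2_iff)
      have "s \<inter> p \<noteq> {}" "s \<inter> q \<noteq> {}" "s \<inter> r \<noteq> {}"
        using assms(2)[OF s pq(1)] assms(2)[OF s pq(2)] assms(2)[OF s r] .
      then show "s \<in> set [p,q,r]" using a b ab rab uv by auto
    qed
    then show False using card_le_length[of L "[p,q,r]"] assms(3) by simp
  qed
  then show ?thesis using that by blast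
qed

section \<open>Links, and families in which no two edges meet in exactly one vertex\<close>

context P_free_3graph
begin

definition link :: "'a \<Rightarrow> 'a set set" where
  "link x = {p. x \<notin> p \<and> insert x p \<in> E}"

lemma link_card: "p \<in> link x \<Longrightarrow> card p = 2"
proof -
  assume p: "p \<in> link x"
  then have "finite p" using edge_finite[of "insert x p"] by (simp add: link_def)
  then show ?thesis using p edge_card[of "insert x p"] by (simp add: link_def)
qed

lemma link_sub: "p \<in> link x \<Longrightarrow> p \<subseteq> V - {x}"
  using edge_sub by (auto simp: link_def)

lemma fin_link: "finite (link x)"
  by (rule finite_subset[of _ "Pow V"]) (use link_sub fin_V in auto)

lemma edges_through: "{e \<in> E. x \<in> e} = insert x ` link x"
proof
  show "{e \<in> E. x \<in> e} \<subseteq> insert x ` link x"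
  proof
    fix e assume "e \<in> {e \<in> E. x \<in> e}"
    then have "e - {x} \<in> link x" "e = insert x (e - {x})" by (auto simp: link_def insert_absorb)
    then show "e \<in> insert x ` link x" by blast
  qed
qed (auto simp: link_def)

lemma card_edges_through: "card {e \<in> E. x \<in> e} = card (link x)"
proof -
  have "inj_on (insert x) (link x)"
  proof (rule inj_onI)
    fix p q assume "p \<in> link x" "q \<in> link x" "insert x p = insert x q"
    moreover from this have "x \<notin> p" "x \<notin> q" by (simp_all add: link_def)
    ultimately show "p = q" by (simp add: insert_ident)
  qed
  then show ?thesis unfolding edges_through by (rule card_image)
qed

text \<open>If all degrees are at most 3, counting incidences gives
  \<open>card E \<le> card V\<close>. Otherwise some \<open>x\<close> has an intersecting link of
  size at least 4, which is a star at some \<open>y\<close>. With \<open>T\<close> the leaves of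
  that star, an edge avoiding \<open>x\<close> also avoids \<open>y\<close> and \<open>T\<close>, as
  it would meet some \<open>{x,y,t}\<close> in one vertex. The number \<open>D\<close> is the degree
  of \<open>x\<close>.\<close>

lemma no_single_intersection_bound:
  assumes "\<And>e f. e \<in> E \<Longrightarrow> f \<in> E \<Longrightarrow> card (e \<inter> f) \<noteq> 1"
  shows "card E \<le> card V \<or> (\<exists>D\<ge>4. D + 2 \<le> card V \<and> card E \<le> D + ((card V - 2 - D) choose 3))"
proof (cases "\<forall>v\<in>V. card (link v) \<le> 3")
  case True
  have "3 * card E \<le> 3 * card V"
  proof (rule double_count_le[OF fin_E fin_V])
    show "3 \<le> card (g \<inter> V)" if "g \<in> E" for g
      using edge_card[OF that] edge_sub[OF that] by (simp add: Int_absorb2)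
    show "card {g \<in> E. v \<in> g} \<le> 3" if "v \<in> V" for v
      using True that by (simp add: card_edges_through)
  qed
  then show ?thesis by simp
next
  case False
  then obtain x where x: "x \<in> V" "4 \<le> card (link x)" by force
  have "p \<inter> q \<noteq> {}" if "p \<in> link x" "q \<in> link x" for p q
  proof
    assume "p \<inter> q = {}"
    then have "insert x p \<inter> insert x q = {x}" by auto
    then have "card (insert x p \<inter> insert x q) = 1" by (rule card_eq_1I)
    then show False using assms[of "insert x p" "insert x q"] that unfolding link_def by blast
  qed
  then obtain y where y: "\<And>p. p \<in> link x \<Longrightarrow> y \<in> p"
    using intersecting_pairs_star[of "link x"] link_card x(2) by blast
  define T where "T = {t. {y,t} \<in> link x}"
  have "link x \<noteq> {}" using x(2) by auto
  then have yV: "y \<in> V" "y \<noteq> x" using y link_sub by blast+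
  have TV: "T \<subseteq> V - {x,y}"
  proof
    fix t assume "t \<in> T"
    then have "{y,t} \<in> link x" by (simp add: T_def)
    from link_sub[OF this] link_card[OF this] show "t \<in> V - {x,y}" by auto
  qed
  have fT: "finite T" using TV fin_V finite_subset by blast
  have lT: "link x = (\<lambda>t. {y,t}) ` T"
  proof
    show "link x \<subseteq> (\<lambda>t. {y,t}) ` T"
    proof
      fix p assume p: "p \<in> link x"
      then obtain t where "p = {y,t}" using y[OF p] link_card[OF p] by (auto simp: card_2_iff)
      then show "p \<in> (\<lambda>t. {y,t}) ` T" using p by (auto simp: T_def)
    qed
  qed (auto simp: T_def)
  have "card (link x) = card T" unfolding lT
    by (rule card_image) (auto simp: inj_on_def doubleton_eq_iff)
  with x have T4: "4 \<le> card T" by simp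
  have TE: "{x,y,t} \<in> E" if "t \<in> T" for t using that by (auto simp: T_def link_def)
  have out: "g \<subseteq> V - {x,y} - T" if g: "g \<in> E" "x \<notin> g" for g
  proof -
    have "y \<notin> g"
    proof
      assume yg: "y \<in> g"
      \<comment> \<open>Here the degree 4 matters: \<open>g\<close> has three vertices, so some
        \<open>{x,y,t}\<close> meets it only in \<open>y\<close>.\<close>
      have "\<not> T \<subseteq> g" using card_mono[OF edge_finite[OF g(1)], of T] edge_card[OF g(1)] T4 by auto
      then obtain t where t: "t \<in> T" "t \<notin> g" by blast
      then have "g \<inter> {x,y,t} = {y}" using yg g by auto
      then show False using assms[OF g(1) TE[OF t(1)]] by simp
    qed
    moreover have "t \<notin> g" if "t \<in> T" for t
    proof
      assume "t \<in> g"
      then have "g \<inter> {x,y,t} = {t}" using g \<open>y \<notin> g\<close> by auto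
      then show False using assms[OF g(1) TE[OF that]] by simp
    qed
    ultimately show ?thesis using edge_sub[OF g(1)] g(2) by blast
  qed
  have "{g \<in> E. x \<notin> g} \<subseteq> triples (V - {x,y} - T)" using out edge_card by (auto simp: triples_def)
  then have "card {g \<in> E. x \<notin> g} \<le> card (triples (V - {x,y} - T))"
    using fin_V by (intro card_mono finite_triples) auto
  also have "\<dots> = (card V - 2 - card T) choose 3"
    using fin_V card_triples[of "V - {x,y} - T"] TV x(1) yV fT by (simp add: card_Diff_subset)
  finally have c: "card {g \<in> E. x \<notin> g} \<le> (card V - 2 - card T) choose 3" .
  have "E = {e \<in> E. x \<in> e} \<union> {g \<in> E. x \<notin> g}" by auto
  then have "card E \<le> card T + ((card V - 2 - card T) choose 3)"
    using card_Un_le[of "{e \<in> E. x \<in> e}" "{g \<in> E. x \<notin> g}"] c card_edges_through[of x]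
      \<open>card (link x) = card T\<close> by simp
  moreover have "card T + 2 \<le> card V"
    using card_mono[of "V - {x,y}" T] TV fin_V x(1) yV T4 by (simp add: card_Diff_subset)
  ultimately show ?thesis using T4 by blast
qed

end

section \<open>A link with a matching of size three\<close>

locale triangle_free_P_free = P_free_3graph +
  assumes no_triangle_sets: "\<lbrakk>e \<in> E; f \<in> E; g \<in> E; card (e \<inter> f) = 1; card (f \<inter> g) = 1;
    card (e \<inter> g) = 1; e \<inter> f \<inter> g = {}\<rbrakk> \<Longrightarrow> False"
begin

lemma no_triangle:
  assumes "{a,b,c} \<in> E" "{c,d,e} \<in> E" "{e,f,a} \<in> E" "distinct [a,b,c,d,e,f]"
  shows False
  by (rule no_triangle_sets[OF assms(1-3)]) (use assms(4) in auto)

text \<open>If \<open>g\<close> missed \<open>q\<close>, then \<open>g\<close>,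
  \<open>insert x p\<close>, \<open>insert x q\<close> would be a loose path; if it met
  \<open>q\<close> in one vertex, they would be a loose triangle.\<close>

lemma link_cut:
  assumes "p \<in> link x" "q \<in> link x" "p \<inter> q = {}" "g \<in> E" "x \<notin> g" "card (g \<inter> p) = 1"
  shows "q \<subseteq> g"
proof -
  have E: "insert x p \<in> E" "insert x q \<in> E" using assms by (auto simp: link_def)
  have pq: "insert x p \<inter> insert x q = {x}" using assms by auto
  have gp: "g \<inter> insert x p = g \<inter> p" "g \<inter> insert x q = g \<inter> q" using assms by auto
  have fq: "finite q" "card q = 2" using link_card[OF assms(2)] card.infinite by fastforce+
  have "g \<inter> q \<noteq> {}"
    using no_path_sets[of g "insert x p" "insert x q"] E pq gp assms by auto
  then have "card (g \<inter> q) \<noteq> 0" using fq by simp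
  moreover have "card (g \<inter> q) \<noteq> 1"
    using no_triangle_sets[of g "insert x p" "insert x q"] E pq gp assms by auto
  moreover have "card (g \<inter> q) \<le> 2" using card_mono[of q "g \<inter> q"] fq by simp
  ultimately have "card (g \<inter> q) = card q" using fq by linarith
  then have "g \<inter> q = q" using fq by (metis Int_lower2 card_subset_eq)
  then show ?thesis by blast
qed

end

text \<open>Here \<open>k\<close>, \<open>j\<close>, \<open>i\<close> stand for the sizes of the
  sets \<open>R\<close>, \<open>J\<close>, \<open>I\<close> introduced below, \<open>l\<close> for
  the link edges in \<open>J\<close>, and \<open>h\<close> for the edges avoiding the centre that
  meet \<open>J\<close>. The excluded \<open>k = 8\<close> is the comet: with \<open>j = 3\<close>
  and \<open>i = 0\<close> the bound would be 28 + 3 + 1 = 32.\<close>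

lemma large_matching_arith:
  fixes k j i :: nat
  assumes "k + j + i = 11" "3 \<le> j + i" "3 \<le> k div 2 + j div 2" "k \<noteq> 8"
    "l \<le> j" "2 * h \<le> max 1 i * j"
  shows "(k choose 2) + l + h + (i choose 3) \<le> 31"
proof -
  \<comment> \<open>\<open>k\<close> stops at 8 because \<open>j + i\<close> is at least 3; the
    finitely many cases are evaluated.\<close>
  have "\<forall>k\<in>set [0..<9]. \<forall>j\<in>set [0..<12]. k + j \<le> 11 \<longrightarrow> 3 \<le> k div 2 + j div 2 \<longrightarrow> k = 8 \<or>
     (k choose 2) + j + (max 1 (11 - k - j) * j) div 2 + ((11 - k - j) choose 3) \<le> (31::nat)"
    by code_simp
  moreover have "k \<in> set [0..<9]" "j \<in> set [0..<12]" "k + j \<le> 11" "i = 11 - k - j" using assms by auto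
  ultimately have "(k choose 2) + j + (max 1 i * j) div 2 + (i choose 3) \<le> 31" using assms by blast
  then show ?thesis using assms(5,6) by linarith
qed

locale link_matching3 = triangle_free_P_free +
  fixes x :: 'a and p1 p2 p3 :: "'a set"
  assumes m: "p1 \<in> link x" "p2 \<in> link x" "p3 \<in> link x"
    and disj: "p1 \<inter> p2 = {}" "p1 \<inter> p3 = {}" "p2 \<inter> p3 = {}"
begin

text \<open>Suppose \<open>q = {u,v}\<close> with only \<open>u\<close> in \<open>g\<close>. By
  \<open>link_cut\<close>, every matching edge disjoint from \<open>q\<close> lies in
  \<open>g\<close>, and no matching edge meets \<open>g\<close> in one vertex, since the other two
  would then both lie in \<open>g\<close>. So each of the three matching edges lies in
  \<open>g\<close> or contains \<open>v\<close>. By disjointness at most one contains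
  \<open>v\<close>, and the 3-set \<open>g\<close> holds at most one.\<close>

lemma link_edge_inside:
  assumes "q \<in> link x" "g \<in> E" "x \<notin> g" "q \<inter> g \<noteq> {}"
  shows "q \<subseteq> g"
proof (rule ccontr)
  assume nq: "\<not> q \<subseteq> g"
  obtain u v where uv: "q = {u,v}" "u \<in> g" "v \<notin> g"
    using link_card[OF assms(1)] assms(4) nq by (auto simp: card_2_iff)
  have gq: "card (g \<inter> q) = 1" using uv by simp
  have fin: "finite p" if "p \<in> link x" for p
    using link_card[OF that] card.infinite by fastforce
  have no2: False if "p \<in> link x" "p' \<in> link x" "p \<inter> p' = {}" "p \<subseteq> g" "p' \<subseteq> g" for p p'
  proof -
    have "card (p \<union> p') = 4" using that fin link_card by (simp add: card_Un_disjoint)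
    moreover have "card (p \<union> p') \<le> card g" using that edge_finite[OF assms(2)] by (intro card_mono) auto
    ultimately show False using edge_card[OF assms(2)] by simp
  qed
  have ind: "p \<subseteq> g \<or> p \<inter> g = {}"
    if "p \<in> link x" "p' \<in> link x" "p'' \<in> link x" "p \<inter> p' = {}" "p \<inter> p'' = {}" "p' \<inter> p'' = {}" for p p' p''
  proof (rule ccontr)
    assume "\<not> ?thesis"
    then have "card (g \<inter> p) = 1" using link_card[OF that(1)] by (auto simp: card_2_iff)
    then show False using link_cut[of p x _ g] that assms no2[of p' p''] by blast
  qed
  have a: "p1 \<subseteq> g \<or> p1 \<inter> g = {}" "p2 \<subseteq> g \<or> p2 \<inter> g = {}" "p3 \<subseteq> g \<or> p3 \<inter> g = {}"
    using ind[of p1 p2 p3] ind[of p2 p1 p3] ind[of p3 p1 p2] m disj by blast+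
  have b: "p1 \<inter> q = {} \<Longrightarrow> p1 \<subseteq> g" "p2 \<inter> q = {} \<Longrightarrow> p2 \<subseteq> g" "p3 \<inter> q = {} \<Longrightarrow> p3 \<subseteq> g"
    using link_cut[OF assms(1) _ _ assms(2,3) gq] m by blast+
  have c: "\<not> (p1 \<subseteq> g \<and> p2 \<subseteq> g)" "\<not> (p1 \<subseteq> g \<and> p3 \<subseteq> g)" "\<not> (p2 \<subseteq> g \<and> p3 \<subseteq> g)"
    using no2 m disj by blast+
  \<comment> \<open>If \<open>p\<close> avoids \<open>g\<close> but meets \<open>q\<close>, the
    common vertex is \<open>v\<close>, because \<open>u\<close> lies in \<open>g\<close>.\<close>
  have k: "p \<subseteq> g \<or> v \<in> p" if "p \<subseteq> g \<or> p \<inter> g = {}" "p \<inter> q = {} \<Longrightarrow> p \<subseteq> g" for p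
    using that uv by auto
  have "p1 \<subseteq> g \<or> v \<in> p1" "p2 \<subseteq> g \<or> v \<in> p2" "p3 \<subseteq> g \<or> v \<in> p3"
    by (rule k[OF a(1) b(1)] k[OF a(2) b(2)] k[OF a(3) b(3)]; assumption)+
  moreover have "\<not> (v \<in> p1 \<and> v \<in> p2)" "\<not> (v \<in> p1 \<and> v \<in> p3)" "\<not> (v \<in> p2 \<and> v \<in> p3)"
    using disj by auto
  ultimately show False using c by argo
qed

text \<open>The sets \<open>R\<close>, \<open>J\<close>, \<open>I\<close> partition
  \<open>V - {x}\<close>. Link edges live inside \<open>R\<close> or inside \<open>J\<close>, and
  edges avoiding \<open>x\<close> live inside \<open>J \<union> I\<close>, where \<open>I\<close>
  holds the covered vertices isolated in the link.\<close>

definition W :: "'a set" where "W = \<Union>{g \<in> E. x \<notin> g}"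
definition R :: "'a set" where "R = V - {x} - W"
definition J :: "'a set" where "J = {v \<in> W. \<exists>p\<in>link x. v \<in> p}"
definition I :: "'a set" where "I = W - J"

lemma W_sub: "W \<subseteq> V - {x}" using edge_sub by (auto simp: W_def)

lemma fin_W: "finite W" "finite R" "finite J" "finite I"
proof -
  show "finite W" using W_sub fin_V finite_subset by blast
  then show "finite J" "finite I" by (auto simp: J_def I_def)
  show "finite R" using fin_V by (simp add: R_def)
qed

text \<open>A link edge that touches \<open>W\<close> is contained in an edge avoiding
  \<open>x\<close>, hence in \<open>W\<close>.\<close>

lemma link_split: "p \<in> link x \<Longrightarrow> p \<subseteq> R \<or> p \<subseteq> J"
proof -
  assume p: "p \<in> link x"
  show ?thesis
  proof (cases "p \<inter> W = {}")
    case True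
    then show ?thesis using link_sub[OF p] by (auto simp: R_def)
  next
    case False
    then obtain g where "g \<in> E" "x \<notin> g" "p \<inter> g \<noteq> {}" by (auto simp: W_def)
    then have "p \<subseteq> g" "g \<subseteq> W" using link_edge_inside[OF p] by (auto simp: W_def)
    then show ?thesis using p by (auto simp: J_def)
  qed
qed

lemma card_link_R: "card {p \<in> link x. p \<subseteq> R} \<le> card R choose 2"
proof -
  have "{p \<in> link x. p \<subseteq> R} \<subseteq> {p. p \<subseteq> R \<and> card p = 2}" using link_card by auto
  then have "card {p \<in> link x. p \<subseteq> R} \<le> card {p. p \<subseteq> R \<and> card p = 2}"
    using fin_W by (intro card_mono) auto
  then show ?thesis using n_subsets[OF fin_W(2)] by simp
qed

text \<open>Link degrees in \<open>J\<close> are at most 2: all link edges at \<open>v\<close> lie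
  in one edge \<open>g\<close> through \<open>v\<close>, which has two further vertices.\<close>

lemma card_link_J: "card {p \<in> link x. p \<subseteq> J} \<le> card J"
proof -
  have "2 * card {p \<in> link x. p \<subseteq> J} \<le> 2 * card J"
  proof (rule double_count_le)
    show "finite {p \<in> link x. p \<subseteq> J}" using fin_link by simp
    show "2 \<le> card (g \<inter> J)" if "g \<in> {p \<in> link x. p \<subseteq> J}" for g
      using that link_card[of g x] by (simp add: Int_absorb2)
    fix v assume "v \<in> J"
    then obtain g where g: "g \<in> E" "x \<notin> g" "v \<in> g" by (auto simp: J_def W_def)
    have "{p \<in> {p \<in> link x. p \<subseteq> J}. v \<in> p} \<subseteq> (\<lambda>u. {v,u}) ` (g - {v})"
    proof
      fix p assume p: "p \<in> {p \<in> {p \<in> link x. p \<subseteq> J}. v \<in> p}"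
      then obtain u where u: "p = {v,u}" "u \<noteq> v" using link_card[of p x] by (auto simp: card_2_iff)
      have "p \<subseteq> g" using link_edge_inside[of p g] p g by auto
      then show "p \<in> (\<lambda>u. {v,u}) ` (g - {v})" using u by auto
    qed
    then have "card {p \<in> {p \<in> link x. p \<subseteq> J}. v \<in> p} \<le> card (g - {v})"
      using edge_finite[OF g(1)] by (intro surj_card_le) auto
    then show "card {p \<in> {p \<in> link x. p \<subseteq> J}. v \<in> p} \<le> 2"
      using g edge_card[OF g(1)] by simp
  qed (use fin_W in simp)
  then show ?thesis by simp
qed

text \<open>Each counted edge contains a whole link edge, hence two vertices of \<open>J\<close>.
  Those through a given \<open>v\<close> all contain a link edge \<open>vu\<close>, so they differ
  only in the third vertex.\<close>

lemma card_avoid_J: "2 * card {g \<in> E. x \<notin> g \<and> g \<inter> J \<noteq> {}} \<le> max 1 (card I) * card J"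
proof (rule double_count_le)
  let ?H = "{g \<in> E. x \<notin> g \<and> g \<inter> J \<noteq> {}}"
  show "finite ?H" using fin_E by simp
  show "finite J" by (rule fin_W)
  fix g assume g: "g \<in> ?H"
  then obtain v p where vp: "v \<in> g" "v \<in> p" "p \<in> link x" "v \<in> J" by (auto simp: J_def)
  have pg: "p \<subseteq> g" using link_edge_inside[of p g] vp g by auto
  moreover have "p \<subseteq> J" using vp link_split by (auto simp: R_def J_def)
  ultimately have "card p \<le> card (g \<inter> J)" using fin_W by (intro card_mono) auto
  then show "2 \<le> card (g \<inter> J)" using link_card[OF vp(3)] by simp
next
  let ?H = "{g \<in> E. x \<notin> g \<and> g \<inter> J \<noteq> {}}"
  fix v assume v: "v \<in> J"
  then obtain p where p: "p \<in> link x" "v \<in> p" by (auto simp: J_def)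
  then obtain u where u: "p = {v,u}" "u \<noteq> v" using link_card[of p x] by (auto simp: card_2_iff)
  let ?G = "{g \<in> ?H. v \<in> g}"
  have form: "\<exists>t. g = {t,v,u} \<and> t \<noteq> v \<and> t \<noteq> u" if "g \<in> ?G" for g
  proof -
    have g: "g \<in> E" "x \<notin> g" "v \<in> g" using that by auto
    have "p \<subseteq> g" using link_edge_inside[OF p(1) g(1,2)] p(2) g(3) by blast
    then have "u \<in> g" using u by simp
    then obtain t where "g = {t,v,u}" "t \<noteq> v" "t \<noteq> u"
      using card3_with2[OF edge_card[OF g(1)] g(3), of u] u(2) by blast
    then show ?thesis by blast
  qed
  \<comment> \<open>Two different such edges share the link edge \<open>uv\<close>, so the third vertex of each is isolated.\<close>
  show "card ?G \<le> max 1 (card I)"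
  proof (cases "card ?G \<le> 1")
    case True
    then show ?thesis by (rule le_max_iff_disj[THEN iffD2, OF disjI1])
  next
    case False
    have "?G \<subseteq> (\<lambda>t. {t,v,u}) ` I"
    proof
      fix g assume g: "g \<in> ?G"
      then obtain t where t: "g = {t,v,u}" "t \<noteq> v" "t \<noteq> u" using form[OF g] by blast
      have "\<not> ?G \<subseteq> {g}"
      proof
        assume "?G \<subseteq> {g}"
        then have "card ?G \<le> card {g}" by (rule card_mono[rotated]) simp
        then show False using False by simp
      qed
      then obtain g' where g': "g' \<in> ?G" "g' \<noteq> g" by blast
      obtain t' where t': "g' = {t',v,u}" using form[OF g'(1)] by blast
      have "t \<notin> g'" using g'(2) t t' by blast
      \<comment> \<open>A link edge at \<open>t\<close> would lie in \<open>g = {t,v,u}\<close>, so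
        it would meet \<open>g'\<close> in \<open>u\<close> or \<open>v\<close> and lie in
        \<open>g'\<close>, which misses \<open>t\<close>.\<close>
      have "t \<notin> J"
      proof
        assume "t \<in> J"
        then obtain q where q: "q \<in> link x" "t \<in> q" by (auto simp: J_def)
        have "q \<subseteq> g" by (rule link_edge_inside[OF q(1)]) (use g q(2) t(1) in auto)
        moreover have "q \<noteq> {t}" using link_card[OF q(1)] by auto
        ultimately have "q \<inter> g' \<noteq> {}" using t(1) t' q by blast
        then have "q \<subseteq> g'" using link_edge_inside[of q g'] q g' by blast
        then show False using q \<open>t \<notin> g'\<close> by blast
      qed
      moreover have "t \<in> W" using g t(1) unfolding W_def by blast
      ultimately show "g \<in> (\<lambda>t. {t,v,u}) ` I" using t(1) unfolding I_def by blast
    qed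
    then have "card ?G \<le> card I" by (rule surj_card_le[OF fin_W(4)])
    then show ?thesis by (rule le_max_iff_disj[THEN iffD2, OF disjI2])
  qed
qed

lemma card_avoid_I: "card {g \<in> E. x \<notin> g \<and> g \<inter> J = {}} \<le> card I choose 3"
proof -
  have "{g \<in> E. x \<notin> g \<and> g \<inter> J = {}} \<subseteq> triples I"
    using edge_card by (auto simp: triples_def I_def W_def)
  then have "card {g \<in> E. x \<notin> g \<and> g \<inter> J = {}} \<le> card (triples I)"
    using fin_W by (intro card_mono finite_triples)
  then show ?thesis using card_triples[OF fin_W(4)] by simp
qed

text \<open>Each of the three disjoint pairs lies in \<open>R\<close> or in \<open>J\<close>, and a
  set \<open>S\<close> holds at most \<open>card S div 2\<close> of them.\<close>

lemma matching_sizes: "3 \<le> card R div 2 + card J div 2"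
proof -
  define M where "M = {p1,p2,p3}"
  have ne: "p \<noteq> {}" if "p \<in> link x" for p using link_card[OF that] by auto
  have "p1 \<noteq> p2" "p1 \<noteq> p3" "p2 \<noteq> p3" using m[THEN ne] disj by auto
  then have cM: "card M = 3" by (simp add: M_def)
  have bound: "2 * card {p \<in> M. p \<subseteq> S} \<le> card S" if "finite S" for S
  proof -
    have "card (\<Union>{p \<in> M. p \<subseteq> S}) = (\<Sum>p\<in>{p \<in> M. p \<subseteq> S}. card p)"
    proof (rule card_Union_disjoint)
      have "p2 \<inter> p1 = {}" "p3 \<inter> p1 = {}" "p3 \<inter> p2 = {}" using disj by blast+
      then have "pairwise disjnt M" using disj by (auto simp: M_def pairwise_insert disjnt_def)
      then show "pairwise disjnt {p \<in> M. p \<subseteq> S}" by (rule pairwise_subset) auto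
      show "finite p" if "p \<in> {p \<in> M. p \<subseteq> S}" for p
        using that finite_subset[OF _ \<open>finite S\<close>] by simp
    qed
    also have "\<dots> = (\<Sum>p\<in>{p \<in> M. p \<subseteq> S}. 2)"
      using m[THEN link_card] by (intro sum.cong) (auto simp: M_def)
    finally have "2 * card {p \<in> M. p \<subseteq> S} = card (\<Union>{p \<in> M. p \<subseteq> S})" by simp
    also have "\<dots> \<le> card S" using that by (intro card_mono) auto
    finally show ?thesis .
  qed
  have "M = {p \<in> M. p \<subseteq> R} \<union> {p \<in> M. p \<subseteq> J}" using m[THEN link_split] unfolding M_def by blast
  then have "3 \<le> card {p \<in> M. p \<subseteq> R} + card {p \<in> M. p \<subseteq> J}"
    using cM card_Un_le[of "{p \<in> M. p \<subseteq> R}" "{p \<in> M. p \<subseteq> J}"] by simp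
  moreover have "card {p \<in> M. p \<subseteq> R} \<le> card R div 2" "card {p \<in> M. p \<subseteq> J} \<le> card J div 2"
    using bound[OF fin_W(2)] bound[OF fin_W(3)] by linarith+
  ultimately show ?thesis by linarith
qed

text \<open>Since \<open>card R + card W = 11\<close>, any other size of \<open>W\<close> means
  \<open>card R \<noteq> 8\<close>, and the arithmetic lemma leaves at most 31 edges. The edge
  \<open>g0\<close> ensures that \<open>W\<close> has at least three vertices.\<close>

lemma link_matching3_bound:
  assumes "card V = 12" "32 \<le> card E" "g0 \<in> E" "x \<notin> g0"
  shows "card W = 3"
proof (rule ccontr)
  assume n: "card W \<noteq> 3"
  have xV: "x \<in> V" using m(1) edge_sub by (auto simp: link_def)
  have "card (V - {x}) = 11" using assms xV by simp
  then have RW: "card R + card W = 11"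
    using W_sub fin_W fin_V by (simp add: R_def card_Diff_subset card_mono)
      (metis W_sub card_mono diff_add finite_Diff)
  have JI: "card J + card I = card W"
    using fin_W card_Diff_subset[of J W] card_mono[of W J] by (auto simp: I_def J_def)
  have "g0 \<subseteq> W" using assms by (auto simp: W_def)
  then have W3: "3 \<le> card W" using card_mono[of W g0] edge_card[OF assms(3)] fin_W by auto
  let ?LR = "{p \<in> link x. p \<subseteq> R}" and ?LJ = "{p \<in> link x. p \<subseteq> J}"
    and ?HJ = "{g \<in> E. x \<notin> g \<and> g \<inter> J \<noteq> {}}" and ?HI = "{g \<in> E. x \<notin> g \<and> g \<inter> J = {}}"
  have "link x = ?LR \<union> ?LJ" using link_split by auto
  then have l: "card (link x) \<le> card ?LR + card ?LJ" using card_Un_le[of ?LR ?LJ] by simp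
  have "E = {e \<in> E. x \<in> e} \<union> ?HJ \<union> ?HI" by auto
  then have "card E \<le> card (link x) + card ?HJ + card ?HI"
    using card_Un3_le[of "{e \<in> E. x \<in> e}" ?HJ ?HI] card_edges_through[of x] by simp
  also have "\<dots> \<le> (card R choose 2) + card ?LJ + card ?HJ + (card I choose 3)"
    using l card_link_R card_avoid_I by linarith
  also have "\<dots> \<le> 31"
    using RW JI W3 n matching_sizes card_link_J card_avoid_J
    by (intro large_matching_arith[where j = "card J"]) linarith+
  finally show False using assms by simp
qed

end

section \<open>Links without a matching of size three\<close>

locale small_links = triangle_free_P_free +
  assumes no_matching3: "\<lbrakk>p \<in> link y; q \<in> link y; r \<in> link y; p \<inter> q = {}; p \<inter> r = {}; q \<inter> r = {}\<rbrakk> \<Longrightarrow> False"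
begin

text \<open>Lets the bound for 7 vertices be applied to the edges that avoid a sunflower on 5 of the
  12 vertices.\<close>

lemma induced: "T \<subseteq> V \<Longrightarrow> small_links T {e \<in> E. e \<subseteq> T}"
proof -
  assume T: "T \<subseteq> V"
  interpret H: P_free_3graph T "{e \<in> E. e \<subseteq> T}"
  proof
    show "is_3graph T {e \<in> E. e \<subseteq> T}"
      using T fin_V finite_subset edge_card by (auto simp: is_3graph_def)
    show "\<not> contains_P {e \<in> E. e \<subseteq> T}"
    proof
      assume "contains_P {e \<in> E. e \<subseteq> T}"
      then obtain a b c d e f g where "distinct [a,b,c,d,e,f,g]" "{a,b,c} \<in> {e \<in> E. e \<subseteq> T}"
        "{c,d,e} \<in> {e \<in> E. e \<subseteq> T}" "{e,f,g} \<in> {e \<in> E. e \<subseteq> T}"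
        unfolding contains_P_def by (elim exE conjE)
      then show False using no_path[of a b c d e f g] by simp
    qed
  qed
  have sub: "H.link y \<subseteq> link y" for y by (auto simp: H.link_def link_def)
  show ?thesis
  proof
    fix e f g
    assume "e \<in> {e \<in> E. e \<subseteq> T}" "f \<in> {e \<in> E. e \<subseteq> T}" "g \<in> {e \<in> E. e \<subseteq> T}"
      and "card (e \<inter> f) = 1" "card (f \<inter> g) = 1" "card (e \<inter> g) = 1" "e \<inter> f \<inter> g = {}"
    then show False using no_triangle_sets[of e f g] by simp
  next
    fix p y q r
    assume "p \<in> H.link y" "q \<in> H.link y" "r \<in> H.link y" "p \<inter> q = {}" "p \<inter> r = {}" "q \<inter> r = {}"
    then show False using no_matching3[of p y q r] sub by (meson subsetD)
  qed
qed

end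

lemma card_le2_of_four:
  assumes "X \<subseteq> E \<inter> {A,B,C,D}"
  shows "A \<notin> E \<Longrightarrow> B \<notin> E \<Longrightarrow> card X \<le> 2" "C \<notin> E \<Longrightarrow> D \<notin> E \<Longrightarrow> card X \<le> 2"
proof -
  show "card X \<le> 2" if "A \<notin> E" "B \<notin> E"
    using card_le_length[of X "[C,D]"] assms that by fastforce
  show "card X \<le> 2" if "C \<notin> E" "D \<notin> E"
    using card_le_length[of X "[A,B]"] assms that by fastforce
qed

text \<open>Shaped for the six pairs in \<open>{a,b,c,d}\<close>: \<open>C\<close>, \<open>D\<close>
  and \<open>F\<close>, \<open>G\<close> will be the two perfect matchings between
  \<open>{a,b}\<close> and \<open>{c,d}\<close>.\<close>

lemma card_of_six:
  assumes "X \<subseteq> E \<inter> {A,B,C,D,F,G}"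
  shows "C \<notin> E \<Longrightarrow> F \<notin> E \<Longrightarrow> G \<notin> E \<Longrightarrow> D \<notin> E \<Longrightarrow> card X \<le> 2"
    "\<not> (C \<in> E \<and> D \<in> E) \<Longrightarrow> \<not> (F \<in> E \<and> G \<in> E) \<Longrightarrow> card X \<le> 4"
proof -
  show "card X \<le> 2" if "C \<notin> E" "F \<notin> E" "G \<notin> E" "D \<notin> E"
  proof -
    have "X \<subseteq> set [A,B]" using assms that by auto
    from card_le_length[OF this] show ?thesis by simp
  qed
  show "card X \<le> 4" if "\<not> (C \<in> E \<and> D \<in> E)" "\<not> (F \<in> E \<and> G \<in> E)"
  proof -
    have "X \<subseteq> set [A,B,if C \<in> E then C else D,if F \<in> E then F else G]" using assms that by auto
    from card_le_length[OF this] show ?thesis by simp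
  qed
qed

text \<open>
  Two edges \<open>xab\<close>, \<open>xcd\<close> meeting only in \<open>x\<close>. An edge with vertices both inside and outside
  \<open>{x,a,b,c,d}\<close> has a single vertex outside, and its inner pair is one of the six pairs
  contained in \<open>xab\<close> or \<open>xcd\<close>.
\<close>

locale sunflower = small_links +
  fixes x a b c d :: 'a
  assumes dist: "distinct [x,a,b,c,d]" and xab: "{x,a,b} \<in> E" and xcd: "{x,c,d} \<in> E"
begin

text \<open>These symmetries let each fact below be proved for one pair or vertex and carried over
  to the others.\<close>

lemma swap_ab: "sunflower V E x b a c d" and swap_cd: "sunflower V E x a b d c"
  and swap_pairs: "sunflower V E x c d a b"
  by (unfold_locales; use dist xab xcd in \<open>auto simp: insert_commute\<close>)+

lemma no_mixed0: "t \<notin> {x,a,b,c,d} \<Longrightarrow> {a,c,t} \<notin> E"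
  using no_triangle[of a b x d c t] dist xab xcd by (auto simp: insert_commute)

lemma no_mixed:
  assumes "t \<notin> {x,a,b,c,d}"
  shows "{a,c,t} \<notin> E" "{a,d,t} \<notin> E" "{b,c,t} \<notin> E" "{b,d,t} \<notin> E"
  using assms no_mixed0[of t] sunflower.no_mixed0[OF swap_ab, of t] sunflower.no_mixed0[OF swap_cd, of t]
    sunflower.no_mixed0[OF sunflower.swap_ab[OF swap_cd], of t] by simp_all

lemma no_two_outside_x: "t \<notin> {x,a,b,c,d} \<Longrightarrow> t' \<notin> {x,a,b,c,d} \<Longrightarrow> t \<noteq> t' \<Longrightarrow> {x,t,t'} \<notin> E"
  using no_matching3[of "{a,b}" x "{c,d}" "{t,t'}"] dist xab xcd by (auto simp: link_def)

lemma no_two_outside_a: "t \<notin> {x,a,b,c,d} \<Longrightarrow> t' \<notin> {x,a,b,c,d} \<Longrightarrow> t \<noteq> t' \<Longrightarrow> {a,t,t'} \<notin> E"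
  using no_path[of t t' a b x c d] dist xab xcd by (auto simp: insert_commute)

lemma no_two_outside:
  assumes "t \<notin> {x,a,b,c,d}" "t' \<notin> {x,a,b,c,d}" "t \<noteq> t'" "s \<in> {x,a,b,c,d}"
  shows "{s,t,t'} \<notin> E"
  using assms no_two_outside_x[of t t'] no_two_outside_a[of t t']
    sunflower.no_two_outside_a[OF swap_ab, of t t'] sunflower.no_two_outside_a[OF swap_pairs, of t t']
    sunflower.no_two_outside_a[OF sunflower.swap_ab[OF swap_pairs], of t t'] by auto

text \<open>Distinct \<open>t\<close>, \<open>t'\<close> would give the link of \<open>x\<close> a
  third disjoint pair. Together with the \<open>page_agree\<close> facts, where a page is an edge
  adding an outside vertex to \<open>ab\<close> or \<open>cd\<close>, this makes the attachments to
  \<open>xa\<close>, \<open>xb\<close>, \<open>ab\<close> agree.\<close>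

lemma link_agree_ab:
  "t \<notin> {x,a,b,c,d} \<Longrightarrow> t' \<notin> {x,a,b,c,d} \<Longrightarrow> {x,a,t} \<in> E \<Longrightarrow> {x,b,t'} \<in> E \<Longrightarrow> t = t'"
  using no_matching3[of "{a,t}" x "{b,t'}" "{c,d}"] dist xab xcd by (auto simp: link_def)

lemmas link_agree_cd = sunflower.link_agree_ab[OF swap_pairs]

lemma page_agree_a:
  "t \<notin> {x,a,b,c,d} \<Longrightarrow> t' \<notin> {x,a,b,c,d} \<Longrightarrow> {x,a,t} \<in> E \<Longrightarrow> {a,b,t'} \<in> E \<Longrightarrow> t = t'"
  using no_path[of t' b a t x c d] dist xab xcd by (auto simp: insert_commute)

lemma page_agree_b:
  "t \<notin> {x,a,b,c,d} \<Longrightarrow> t' \<notin> {x,a,b,c,d} \<Longrightarrow> {x,b,t} \<in> E \<Longrightarrow> {a,b,t'} \<in> E \<Longrightarrow> t = t'"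
  using sunflower.page_agree_a[OF swap_ab, of t t'] by (simp add: insert_commute)

lemmas page_agree_c = sunflower.page_agree_a[OF swap_pairs]
lemmas page_agree_d = sunflower.page_agree_b[OF swap_pairs]

lemma link_outside_a:
  "{x,a,t} \<in> E \<Longrightarrow> {t,t1,t2} \<in> E \<Longrightarrow> distinct [t,t1,t2] \<Longrightarrow> {t,t1,t2} \<inter> {x,a,b,c,d} = {} \<Longrightarrow> False"
  using no_path[of t1 t2 t a x c d] dist xab xcd by (auto simp: insert_commute)

lemma link_outside:
  assumes "{x,s,t} \<in> E" "s \<in> {a,b,c,d}" "{t,t1,t2} \<in> E" "distinct [t,t1,t2]"
    "{t,t1,t2} \<inter> {x,a,b,c,d} = {}"
  shows False
  using assms link_outside_a[of t t1 t2]
    sunflower.link_outside_a[OF swap_ab, of t t1 t2] sunflower.link_outside_a[OF swap_pairs, of t t1 t2]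
    sunflower.link_outside_a[OF sunflower.swap_ab[OF swap_pairs], of t t1 t2] by auto

text \<open>An edge outside the sunflower, the page \<open>{a,b,t}\<close> and either of these
  triples would form a path.\<close>

lemma page_outside_ab0:
  assumes "{a,b,t} \<in> E" "{t,t1,t2} \<in> E" "distinct [t,t1,t2]" "{t,t1,t2} \<inter> {x,a,b,c,d} = {}"
  shows "{x,a,c} \<notin> E" "{a,c,d} \<notin> E"
  using no_path[of t1 t2 t b a x c] no_path[of t1 t2 t b a c d] assms dist
  by (auto simp: insert_commute)

lemma page_outside_ab:
  assumes "{a,b,t} \<in> E" "{t,t1,t2} \<in> E" "distinct [t,t1,t2]" "{t,t1,t2} \<inter> {x,a,b,c,d} = {}"
  shows "{x,a,c} \<notin> E" "{x,a,d} \<notin> E" "{x,b,c} \<notin> E" "{x,b,d} \<notin> E" "{a,c,d} \<notin> E" "{b,c,d} \<notin> E"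
proof -
  have ba: "{b,a,t} \<in> E" using assms(1) by (simp add: insert_commute)
  have d: "{t,t1,t2} \<inter> {x,b,a,c,d} = {}" "{t,t1,t2} \<inter> {x,a,b,d,c} = {}" "{t,t1,t2} \<inter> {x,b,a,d,c} = {}"
    using assms(4) by auto
  show "{x,a,c} \<notin> E" "{a,c,d} \<notin> E" by (rule page_outside_ab0[OF assms])+
  show "{x,b,c} \<notin> E" "{b,c,d} \<notin> E"
    by (rule sunflower.page_outside_ab0[OF swap_ab ba assms(2,3) d(1)])+
  show "{x,a,d} \<notin> E"
    by (rule sunflower.page_outside_ab0[OF swap_cd assms(1-3) d(2)])
  show "{x,b,d} \<notin> E"
    by (rule sunflower.page_outside_ab0[OF sunflower.swap_ab[OF swap_cd] ba assms(2,3) d(3)])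
qed

text \<open>Both triples together with \<open>{x,c,d}\<close> would form a loose triangle with core
  \<open>a\<close>, \<open>x\<close>, \<open>c\<close>.\<close>

lemma link_kills_a:
  "t \<notin> {x,a,b,c,d} \<Longrightarrow> {x,a,t} \<in> E \<Longrightarrow> {a,b,c} \<notin> E"
  using no_triangle[of a t x d c b] dist xcd by (auto simp: insert_commute)

lemma link_kills_ab:
  assumes "t \<notin> {x,a,b,c,d}" "{x,a,t} \<in> E \<or> {x,b,t} \<in> E"
  shows "{a,b,c} \<notin> E" "{a,b,d} \<notin> E"
  using assms link_kills_a[of t] sunflower.link_kills_a[OF swap_ab, of t] sunflower.link_kills_a[OF swap_cd, of t]
    sunflower.link_kills_a[OF sunflower.swap_ab[OF swap_cd], of t] by (auto simp: insert_commute)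

text \<open>The page \<open>{a,b,t}\<close> would close two such link edges, which form a perfect
  matching between \<open>{a,b}\<close> and \<open>{c,d}\<close>, to a loose triangle.\<close>

lemma page_kills_ab:
  assumes "t \<notin> {x,a,b,c,d}" "{a,b,t} \<in> E"
  shows "\<not> ({x,a,c} \<in> E \<and> {x,b,d} \<in> E)" "\<not> ({x,a,d} \<in> E \<and> {x,b,c} \<in> E)"
  using no_triangle[of a c x d b t] no_triangle[of a d x c b t] assms dist by (auto simp: insert_commute)

section \<open>Counting edges by their trace on the sunflower\<close>

definition T :: "'a set" where "T = V - {x,a,b,c,d}"
definition N :: "'a \<Rightarrow> 'a \<Rightarrow> 'a set" where "N u v = {t \<in> T. {u,v,t} \<in> E}"
definition LS :: "'a set set" where "LS = {e \<in> E. x \<in> e \<and> e \<subseteq> {x,a,b,c,d}}"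
definition TS :: "'a set set" where "TS = {e \<in> E. x \<notin> e \<and> e \<subseteq> {x,a,b,c,d}}"
definition HT :: "'a set set" where "HT = {e \<in> E. e \<subseteq> T}"

lemma T_out: "t \<in> T \<Longrightarrow> t \<notin> {x,a,b,c,d}" and fin_T: "finite T"
  using fin_V by (auto simp: T_def)

lemma N_T: "N u v \<subseteq> T" and fin_N: "finite (N u v)"
proof -
  show "N u v \<subseteq> T" by (auto simp: N_def)
  then show "finite (N u v)" using fin_T finite_subset by blast
qed

lemma card_T: "card T + 5 = card V"
proof -
  have "{x,a,b,c,d} \<subseteq> V" using edge_sub[OF xab] edge_sub[OF xcd] by simp
  moreover have "card {x,a,b,c,d} = 5" using dist by simp
  ultimately show ?thesis
    using card_mono[OF fin_V, of "{x,a,b,c,d}"] by (simp add: T_def card_Diff_subset)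
qed

text \<open>The straddling edges are grouped by the two edges \<open>xab\<close> and
  \<open>xcd\<close>, because the agreement facts \<open>N_agree\<close> hold within each
  group.\<close>

lemma edge_cases:
  assumes e: "e \<in> E"
  shows "e \<in> LS \<union> TS \<union> HT \<union> ((\<lambda>t. {x,a,t}) ` N x a \<union> (\<lambda>t. {x,b,t}) ` N x b \<union> (\<lambda>t. {a,b,t}) ` N a b)
     \<union> ((\<lambda>t. {x,c,t}) ` N x c \<union> (\<lambda>t. {x,d,t}) ` N x d \<union> (\<lambda>t. {c,d,t}) ` N c d)"
proof (cases "e \<subseteq> {x,a,b,c,d} \<or> e \<subseteq> T")
  case True
  then show ?thesis using e by (auto simp: LS_def TS_def HT_def)
next
  case False
  then obtain t s where ts: "t \<in> e" "t \<in> T" "s \<in> e" "s \<in> {x,a,b,c,d}"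
    using edge_sub[OF e] by (auto simp: T_def)
  then obtain r where r: "e = {r,s,t}" "r \<noteq> s" "r \<noteq> t"
    using card3_with2[OF edge_card[OF e], of s t] T_out by metis
  have t: "t \<notin> {x,a,b,c,d}" using ts T_out by blast
  have rS: "r \<in> {x,a,b,c,d}"
  proof (rule ccontr)
    assume n: "r \<notin> {x,a,b,c,d}"
    show False using no_two_outside[OF n t r(3) ts(4)] e r by (simp add: insert_commute)
  qed
  have page: "e \<in> (\<lambda>t. {u,v,t}) ` N u v" if "{r,s} = {u,v}" for u v
  proof -
    have "e = {u,v,t}" using that r(1) by blast
    then show ?thesis using e ts(2) by (intro image_eqI) (simp_all add: N_def)
  qed
  have "{r,s} \<in> {{x,a},{x,b},{a,b},{x,c},{x,d},{c,d}}"
    using rS ts(4) no_mixed[OF t] e r by (elim insertE emptyE) (simp_all add: insert_commute)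
  then show ?thesis
    using page[of x a] page[of x b] page[of a b] page[of x c] page[of x d] page[of c d]
    unfolding Un_iff insert_iff empty_iff by argo
qed

lemma card_E_le: "card E \<le> card LS + card TS + card HT + (card (N x a) + card (N x b) + card (N a b))
    + (card (N x c) + card (N x d) + card (N c d))"
proof -
  let ?P = "(\<lambda>t. {x,a,t}) ` N x a \<union> (\<lambda>t. {x,b,t}) ` N x b \<union> (\<lambda>t. {a,b,t}) ` N a b"
  let ?Q = "(\<lambda>t. {x,c,t}) ` N x c \<union> (\<lambda>t. {x,d,t}) ` N x d \<union> (\<lambda>t. {c,d,t}) ` N c d"
  have fin: "finite (LS \<union> TS \<union> HT \<union> ?P \<union> ?Q)"
    using fin_E fin_N by (simp add: LS_def TS_def HT_def)
  have "card E \<le> card (LS \<union> TS \<union> HT \<union> ?P \<union> ?Q)"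
    by (rule card_mono[OF fin subsetI[OF edge_cases]])
  also have "\<dots> \<le> card (LS \<union> TS \<union> HT) + card ?P + card ?Q" by (rule card_Un3_le)
  finally show ?thesis
    using card_Un3_le[of LS TS HT]
      card_Un3_le[of "(\<lambda>t. {x,a,t}) ` N x a" "(\<lambda>t. {x,b,t}) ` N x b" "(\<lambda>t. {a,b,t}) ` N a b"]
      card_Un3_le[of "(\<lambda>t. {x,c,t}) ` N x c" "(\<lambda>t. {x,d,t}) ` N x d" "(\<lambda>t. {c,d,t}) ` N c d"]
      card_image_le[OF fin_N, of "\<lambda>t. {x,a,t}" x a] card_image_le[OF fin_N, of "\<lambda>t. {x,b,t}" x b]
      card_image_le[OF fin_N, of "\<lambda>t. {a,b,t}" a b] card_image_le[OF fin_N, of "\<lambda>t. {x,c,t}" x c]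
      card_image_le[OF fin_N, of "\<lambda>t. {x,d,t}" x d] card_image_le[OF fin_N, of "\<lambda>t. {c,d,t}" c d]
    by linarith
qed

lemma N_agree:
  "t \<in> N x a \<Longrightarrow> t' \<in> N x b \<Longrightarrow> t = t'" "t \<in> N x a \<Longrightarrow> t' \<in> N a b \<Longrightarrow> t = t'"
  "t \<in> N x b \<Longrightarrow> t' \<in> N a b \<Longrightarrow> t = t'" "t \<in> N x c \<Longrightarrow> t' \<in> N x d \<Longrightarrow> t = t'"
  "t \<in> N x c \<Longrightarrow> t' \<in> N c d \<Longrightarrow> t = t'" "t \<in> N x d \<Longrightarrow> t' \<in> N c d \<Longrightarrow> t = t'"
  using link_agree_ab[of t t'] page_agree_a[of t t'] page_agree_b[of t t']
    link_agree_cd[of t t'] page_agree_c[of t t'] page_agree_d[of t t'] T_out[of t] T_out[of t']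
  by (auto simp: N_def)

text \<open>\<open>K\<close> is kept general: it is all of \<open>T\<close>, or only the part of
  \<open>T\<close> left uncovered by the outside edges.\<close>

lemma N_bound:
  assumes "finite K"
  shows "N x a \<subseteq> K \<Longrightarrow> N x b \<subseteq> K \<Longrightarrow> N a b \<subseteq> K \<Longrightarrow>
      card (N x a) + card (N x b) + card (N a b) \<le> max (card K) 3"
    "N x c \<subseteq> K \<Longrightarrow> N x d \<subseteq> K \<Longrightarrow> N c d \<subseteq> K \<Longrightarrow>
      card (N x c) + card (N x d) + card (N c d) \<le> max (card K) 3"
  by (intro card_agree3[OF assms]; use N_agree in blast)+

lemma N_bound2:
  "card (N x a) + card (N x b) \<le> max (card T) 2" "card (N x c) + card (N x d) \<le> max (card T) 2"
  by (intro card_pairs_agree[OF fin_T N_T N_T]; use N_agree in blast)+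

lemma LS_sub: "LS \<subseteq> E \<inter> {{x,a,b},{x,c,d},{x,a,c},{x,b,d},{x,a,d},{x,b,c}}"
proof
  fix e assume "e \<in> LS"
  then have e: "e \<in> E" "x \<in> e" "e \<subseteq> {x,a,b,c,d}" by (auto simp: LS_def)
  obtain u v where uv: "e = {u,v,x}" "u \<noteq> v" "u \<noteq> x" "v \<noteq> x"
    using card3_with[OF edge_card[OF e(1)] e(2)] .
  have "u \<in> {a,b,c,d}" "v \<in> {a,b,c,d}" using e uv by auto
  then have "e \<in> {{x,a,b},{x,c,d},{x,a,c},{x,b,d},{x,a,d},{x,b,c}}"
    using uv by (elim insertE emptyE) (simp_all add: insert_commute)
  then show "e \<in> E \<inter> {{x,a,b},{x,c,d},{x,a,c},{x,b,d},{x,a,d},{x,b,c}}" using e by simp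
qed

lemma TS_sub: "TS \<subseteq> E \<inter> {{a,b,c},{a,b,d},{a,c,d},{b,c,d}}"
proof
  fix e assume "e \<in> TS"
  then have e: "e \<in> E" "e \<subseteq> {a,b,c,d}" by (auto simp: TS_def)
  then obtain u v w where uv: "e = {u,v,w}" "u \<noteq> v" "u \<noteq> w" "v \<noteq> w"
    using edge_card[OF e(1)] by (auto simp: card_3_iff)
  have "u \<in> {a,b,c,d}" "v \<in> {a,b,c,d}" "w \<in> {a,b,c,d}" using e uv by auto
  then have "e \<in> {{a,b,c},{a,b,d},{a,c,d},{b,c,d}}"
    using uv by (elim insertE emptyE) (simp_all add: insert_commute)
  then show "e \<in> E \<inter> {{a,b,c},{a,b,d},{a,c,d},{b,c,d}}" using e by simp
qed

lemma LS_le6: "card LS \<le> 6" and TS_le4: "card TS \<le> 4"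
  using card_le_length[of LS "[{x,a,b},{x,c,d},{x,a,c},{x,b,d},{x,a,d},{x,b,c}]"] LS_sub
    card_le_length[of TS "[{a,b,c},{a,b,d},{a,c,d},{b,c,d}]"] TS_sub by auto

lemma TS_le2:
  "{a,b,c} \<notin> E \<Longrightarrow> {a,b,d} \<notin> E \<Longrightarrow> card TS \<le> 2"
  "{a,c,d} \<notin> E \<Longrightarrow> {b,c,d} \<notin> E \<Longrightarrow> card TS \<le> 2"
  using card_le2_of_four[OF TS_sub] by blast+

lemma LS_le2:
  "{x,a,c} \<notin> E \<Longrightarrow> {x,a,d} \<notin> E \<Longrightarrow> {x,b,c} \<notin> E \<Longrightarrow> {x,b,d} \<notin> E \<Longrightarrow> card LS \<le> 2"
  using card_of_six(1)[OF LS_sub] by blast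

lemma LS_le4:
  "\<not> ({x,a,c} \<in> E \<and> {x,b,d} \<in> E) \<Longrightarrow> \<not> ({x,a,d} \<in> E \<and> {x,b,c} \<in> E) \<Longrightarrow> card LS \<le> 4"
  using card_of_six(2)[OF LS_sub] .

lemma TS_le2_link:
  assumes "0 < card (N x a) + card (N x b) \<or> 0 < card (N x c) + card (N x d)"
  shows "card TS \<le> 2"
proof -
  have "N x a \<noteq> {} \<or> N x b \<noteq> {} \<or> N x c \<noteq> {} \<or> N x d \<noteq> {}" using assms by auto
  then obtain t where t: "t \<in> T" "{x,a,t} \<in> E \<or> {x,b,t} \<in> E \<or> {x,c,t} \<in> E \<or> {x,d,t} \<in> E"
    by (auto simp: N_def)
  have o: "t \<notin> {x,a,b,c,d}" "t \<notin> {x,c,d,a,b}" using T_out[OF t(1)] by auto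
  show ?thesis
  proof (cases "{x,a,t} \<in> E \<or> {x,b,t} \<in> E")
    case True
    then show ?thesis using link_kills_ab[OF o(1)] TS_le2(1) by blast
  next
    case False
    then have "{x,c,t} \<in> E \<or> {x,d,t} \<in> E" using t by blast
    from sunflower.link_kills_ab[OF swap_pairs o(2) this] TS_le2(2) show ?thesis
      by (simp add: insert_commute)
  qed
qed

lemma LS_le4_page:
  assumes "0 < card (N a b) \<or> 0 < card (N c d)"
  shows "card LS \<le> 4"
proof -
  have "N a b \<noteq> {} \<or> N c d \<noteq> {}" using assms by auto
  then obtain t where t: "t \<in> T" "{a,b,t} \<in> E \<or> {c,d,t} \<in> E"
    by (auto simp: N_def)
  have o: "t \<notin> {x,a,b,c,d}" "t \<notin> {x,c,d,a,b}" using T_out[OF t(1)] by auto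
  show ?thesis
    using t(2) page_kills_ab[OF o(1)] sunflower.page_kills_ab[OF swap_pairs o(2)] LS_le4
    by (auto simp: insert_commute)
qed

lemma bound7: "card V = 7 \<Longrightarrow> card E \<le> 12"
proof -
  assume "card V = 7"
  then have T2: "card T = 2" using card_T by simp
  have "HT = {}"
  proof (rule ccontr)
    assume "HT \<noteq> {}"
    then obtain e where "e \<in> E" "e \<subseteq> T" by (auto simp: HT_def)
    then show False using card_mono[OF fin_T, of e] edge_card T2 by fastforce
  qed
  then have h: "card HT = 0" by simp
  have l: "card (N x a) + card (N x b) + card (N a b) \<le> 3" "card (N x c) + card (N x d) + card (N c d) \<le> 3"
    "card (N x a) + card (N x b) \<le> 2" "card (N x c) + card (N x d) \<le> 2"
    using N_bound[OF fin_T] N_bound2 N_T T2 by auto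
  have A: "card (N a b) \<le> 2" "card (N c d) \<le> 2"
    using card_mono[OF fin_T N_T] T2 by metis+
  show ?thesis
    \<comment> \<open>Without outside attachments at most 6 + 4; with link attachments only, 6 + 2 +
      2 + 2; with pages only, 4 + 4 + 2 + 2; with both, 4 + 2 + 3 + 3.\<close>
    by (cases "card (N x a) + card (N x b) = 0"; cases "card (N x c) + card (N x d) = 0";
        cases "card (N a b) = 0"; cases "card (N c d) = 0")
      (use card_E_le h l A LS_le6 TS_le4 TS_le2_link LS_le4_page in linarith)+
qed

text \<open>If outside edges exist, they cover a set \<open>Y\<close> of at least three vertices of
  \<open>T\<close>, and by \<open>link_outside\<close> no link attachment uses \<open>Y\<close>.
  Either pages avoid \<open>Y\<close> too, so that each group attaches to at most 4 vertices, or a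
  page meets \<open>Y\<close> and destroys most edges inside the sunflower.\<close>

lemma bound12:
  assumes "card V = 12" "card HT \<le> 13"
  shows "card E \<le> 31"
proof -
  have T7: "card T = 7" using card_T assms(1) by simp
  have l: "card (N x a) + card (N x b) + card (N a b) \<le> 7" "card (N x c) + card (N x d) + card (N c d) \<le> 7"
    using N_bound[OF fin_T] N_T T7 by auto
  show ?thesis
  proof (cases "HT = {}")
    case True
    then show ?thesis using card_E_le l LS_le6 TS_le4 by simp
  next
    case False
    define Y where "Y = \<Union>HT"
    have YT: "Y \<subseteq> T" by (auto simp: Y_def HT_def)
    obtain e0 where e0: "e0 \<in> E" "e0 \<subseteq> Y" using False by (auto simp: Y_def HT_def)
    have "3 \<le> card Y" using card_mono[OF finite_subset[OF YT fin_T] e0(2)] edge_card[OF e0(1)] by simp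
    then have Y4: "card (T - Y) \<le> 4"
      using T7 card_Diff_subset[OF finite_subset[OF YT fin_T] YT] by simp
    have Y_edge: "\<exists>t1 t2. {t,t1,t2} \<in> E \<and> distinct [t,t1,t2] \<and> {t,t1,t2} \<inter> {x,a,b,c,d} = {}"
      if "t \<in> Y" for t
    proof -
      from that obtain e where e: "e \<in> E" "e \<subseteq> T" "t \<in> e" by (auto simp: Y_def HT_def)
      obtain t1 t2 where "e = {t1,t2,t}" "t1 \<noteq> t2" "t1 \<noteq> t" "t2 \<noteq> t"
        using card3_with[OF edge_card[OF e(1)] e(3)] .
      then have "{t,t1,t2} = e" "distinct [t,t1,t2]" by auto
      moreover have "e \<inter> {x,a,b,c,d} = {}" using e(2) T_out by blast
      ultimately show ?thesis using e by metis
    qed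
    have xs: "N x s \<subseteq> T - Y" if s: "s \<in> {a,b,c,d}" for s
    proof
      fix t assume t: "t \<in> N x s"
      have "t \<notin> Y" using Y_edge[of t] link_outside[of s t, OF _ s] t unfolding N_def by blast
      then show "t \<in> T - Y" using t by (simp add: N_def)
    qed
    show ?thesis
    proof (cases "N a b \<subseteq> T - Y \<and> N c d \<subseteq> T - Y")
      case True
      have "card (N x a) + card (N x b) + card (N a b) \<le> 4" "card (N x c) + card (N x d) + card (N c d) \<le> 4"
        using N_bound[of "T - Y"] xs True Y4 fin_T by auto
      \<comment> \<open>6 + 4 + 13 + 4 + 4 = 31.\<close>
      then show ?thesis using card_E_le LS_le6 TS_le4 assms(2) by linarith
    next
      case False
      then obtain t where t: "t \<in> Y" "{a,b,t} \<in> E \<or> {c,d,t} \<in> E" by (auto simp: N_def)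
      obtain t1 t2 where tt: "{t,t1,t2} \<in> E" "distinct [t,t1,t2]" "{t,t1,t2} \<inter> {x,a,b,c,d} = {}"
        using Y_edge[OF t(1)] by blast
      have tt': "{t,t1,t2} \<inter> {x,c,d,a,b} = {}" using tt(3) by auto
      have "card LS \<le> 2 \<and> card TS \<le> 2"
      proof (cases "{a,b,t} \<in> E")
        case True
        from page_outside_ab[OF this tt] show ?thesis using LS_le2 TS_le2(2) by blast
      next
        case False
        then have "{c,d,t} \<in> E" using t by blast
        from sunflower.page_outside_ab[OF swap_pairs this tt(1,2) tt'] show ?thesis
          using LS_le2 TS_le2(1) by (simp add: insert_commute)
      qed
      \<comment> \<open>2 + 2 + 13 + 7 + 7 = 31.\<close>
      then show ?thesis using card_E_le l assms(2) by linarith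
    qed
  qed
qed

end

section \<open>Edge bounds on 7 and 12 vertices without three disjoint link edges\<close>

context small_links
begin

lemma sunflower_or_bound:
  obtains x a b c d where "sunflower V E x a b c d"
  | "card E \<le> card V" | D where "4 \<le> D" "D + 2 \<le> card V" "card E \<le> D + ((card V - 2 - D) choose 3)"
proof (cases "\<exists>e\<in>E. \<exists>f\<in>E. card (e \<inter> f) = 1")
  case True
  then obtain e f where ef: "e \<in> E" "f \<in> E" "card (e \<inter> f) = 1" by blast
  then obtain x where x: "e \<inter> f = {x}" using card_1_singletonE by blast
  obtain a b where ab: "e = {a,b,x}" "a \<noteq> b" "a \<noteq> x" "b \<noteq> x"
    using card3_with[OF edge_card[OF ef(1)], of x] x by blast
  obtain c d where cd: "f = {c,d,x}" "c \<noteq> d" "c \<noteq> x" "d \<noteq> x"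
    using card3_with[OF edge_card[OF ef(2)], of x] x by blast
  have "a \<notin> f" "b \<notin> f" using x ab by blast+
  then have "distinct [x,a,b,c,d]" using ab cd by auto
  then have "sunflower V E x a b c d"
    using ef ab cd by unfold_locales (simp_all add: insert_commute)
  then show ?thesis using that by blast
next
  case False
  then show ?thesis using no_single_intersection_bound that by blast
qed

text \<open>The value 13 is what the count on 12 vertices can afford for the edges outside a
  sunflower.\<close>

lemma small_links_bound7: "card V = 7 \<Longrightarrow> card E \<le> 13"
proof (cases rule: sunflower_or_bound)
  case (1 x a b c d)
  then show "card V = 7 \<Longrightarrow> card E \<le> 13" using sunflower.bound7 by fastforce
next
  case (3 D)
  assume "card V = 7"
  with 3 have "D = 4 \<or> D = 5" by auto
  then show "card E \<le> 13" using 3 \<open>card V = 7\<close> by (auto simp: numeral_eq_Suc)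
qed simp

lemma small_links_bound12:
  assumes V: "card V = 12"
  shows "card E \<le> 31"
proof (cases rule: sunflower_or_bound)
  case (1 x a b c d)
  then interpret sunflower V E x a b c d .
  have "card HT \<le> 13"
    using small_links.small_links_bound7[OF induced[of T]] card_T V by (simp add: HT_def T_def)
  then show ?thesis by (rule bound12[OF V])
next
  case (3 D)
  then have "D \<in> {4,5,6,7,8,9,10}" using V by auto
  then show ?thesis using 3 V by (elim insertE emptyE) (simp_all add: numeral_eq_Suc)
qed (use V in simp)

end

section \<open>The extremal 3-graph\<close>

context P_free_3graph
begin

lemma triangle_or_free:
  obtains x1 x2 x3 y1 y2 y3 where "P_free_with_triangle V E x1 x2 x3 y1 y2 y3"
  | "triangle_free_P_free V E"
proof (cases "\<exists>e f g. e \<in> E \<and> f \<in> E \<and> g \<in> E \<and> card (e \<inter> f) = 1 \<and> card (f \<inter> g) = 1 \<and>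
    card (e \<inter> g) = 1 \<and> e \<inter> f \<inter> g = {}")
  case False
  then have "triangle_free_P_free V E" by unfold_locales blast
  then show ?thesis using that by blast
next
  case True
  then obtain e f g where efg: "e \<in> E" "f \<in> E" "g \<in> E" "card (e \<inter> f) = 1" "card (f \<inter> g) = 1"
    "card (e \<inter> g) = 1" "e \<inter> f \<inter> g = {}" by blast
  obtain x1 where x1: "e \<inter> f = {x1}" using efg(4) card_1_singletonE by blast
  obtain x2 where x2: "e \<inter> g = {x2}" using efg(6) card_1_singletonE by blast
  obtain x3 where x3: "f \<inter> g = {x3}" using efg(5) card_1_singletonE by blast
  have m: "x1 \<in> e" "x2 \<in> e" "x1 \<in> f" "x3 \<in> f" "x2 \<in> g" "x3 \<in> g" using x1 x2 x3 by auto
  have "\<not> (z \<in> e \<and> z \<in> f \<and> z \<in> g)" for z using efg(7) by blast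
  then have ne: "x1 \<noteq> x2" "x1 \<noteq> x3" "x2 \<noteq> x3" using m by metis+
  obtain y3 where y3: "e = {y3,x1,x2}" "y3 \<noteq> x1" "y3 \<noteq> x2"
    using card3_with2[OF edge_card[OF efg(1)] m(1,2) ne(1)] .
  obtain y2 where y2: "f = {y2,x1,x3}" "y2 \<noteq> x1" "y2 \<noteq> x3"
    using card3_with2[OF edge_card[OF efg(2)] m(3,4) ne(2)] .
  obtain y1 where y1: "g = {y1,x2,x3}" "y1 \<noteq> x2" "y1 \<noteq> x3"
    using card3_with2[OF edge_card[OF efg(3)] m(5,6) ne(3)] .
  have "y3 \<notin> f" "y3 \<notin> g" using x1 x2 y3 by blast+
  moreover have "y2 \<notin> e" "y2 \<notin> g" using x1 x3 y2 by blast+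
  moreover have "y1 \<notin> e" "y1 \<notin> f" using x2 x3 y1 by blast+
  ultimately have "distinct [x1,x2,x3,y1,y2,y3]" using ne y1 y2 y3 by auto
  then have "P_free_with_triangle V E x1 x2 x3 y1 y2 y3"
    using efg(1-3) y1(1) y2(1) y3(1) by unfold_locales (simp_all add: insert_commute)
  then show ?thesis using that by blast
qed

text \<open>The three outcomes place \<open>E\<close> inside a full star, inside two disjoint copies
  of \<open>K_6\<close>, or inside a comet with centre \<open>x\<close> and remaining head vertices
  \<open>W\<close>.\<close>

lemma structure_of_dense:
  assumes V: "card V = 12" and E: "32 \<le> card E"
  obtains x where "x \<in> V" "\<And>e. e \<in> E \<Longrightarrow> x \<in> e"
  | U where "U \<subseteq> V" "card U = 6" "\<And>e. e \<in> E \<Longrightarrow> e \<subseteq> U \<or> e \<subseteq> V - U"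
  | x W where "x \<in> V" "W \<subseteq> V - {x}" "card W = 3"
      "\<And>e. e \<in> E \<Longrightarrow> e \<subseteq> insert x W \<or> x \<in> e \<and> e - {x} \<subseteq> V - {x} - W"
proof (cases rule: triangle_or_free)
  case (1 x1 x2 x3 y1 y2 y3)
  then interpret P_free_with_triangle V E x1 x2 x3 y1 y2 y3 .
  show ?thesis using triangle_bound[OF V] E that(2)[OF U_sub card_U] by fastforce
next
  case 2
  then interpret triangle_free_P_free V E .
  show ?thesis
  proof (cases "\<exists>y p q r. p \<in> link y \<and> q \<in> link y \<and> r \<in> link y \<and> p \<inter> q = {} \<and> p \<inter> r = {} \<and> q \<inter> r = {}")
    case False
    then have "small_links V E" by unfold_locales blast
    then show ?thesis using small_links.small_links_bound12 V E by fastforce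
  next
    case True
    then obtain x p1 p2 p3 where m: "p1 \<in> link x" "p2 \<in> link x" "p3 \<in> link x"
      "p1 \<inter> p2 = {}" "p1 \<inter> p3 = {}" "p2 \<inter> p3 = {}" by blast
    interpret link_matching3 V E x p1 p2 p3 by unfold_locales (rule m)+
    have xV: "x \<in> V" using m(1) edge_sub by (auto simp: link_def)
    show ?thesis
    proof (cases "\<exists>g0\<in>E. x \<notin> g0")
      case False
      then show ?thesis using that(1) xV by blast
    next
      case True
      then have W3: "card W = 3" using link_matching3_bound[OF V E] by blast
      have "e \<subseteq> insert x W \<or> x \<in> e \<and> e - {x} \<subseteq> V - {x} - W" if e: "e \<in> E" for e
      proof (cases "x \<in> e")
        case False
        then show ?thesis using e by (auto simp: W_def)
      next
        case True
        then have "e - {x} \<in> link x" using e by (simp add: link_def insert_absorb)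
        moreover have "J \<subseteq> W" by (auto simp: J_def)
        ultimately show ?thesis using link_split[of "e - {x}"] True unfolding R_def by blast
      qed
      then show ?thesis using that(3) xV W_sub W3 by blast
    qed
  qed
qed

end

text \<open>Builds the relabellings for all three target graphs; for the star and for the two copies
  of \<open>K_6\<close> one part is empty.\<close>

lemma three_part_bij:
  assumes "finite A" "finite B" "finite C" "finite A'" "finite B'" "finite C'"
    "card A = card A'" "card B = card B'" "card C = card C'"
    "A \<inter> B = {}" "A \<inter> C = {}" "B \<inter> C = {}" "A' \<inter> B' = {}" "A' \<inter> C' = {}" "B' \<inter> C' = {}"
  obtains f where "bij_betw f A A'" "bij_betw f B B'" "bij_betw f C C'"
    "bij_betw f (A \<union> B \<union> C) (A' \<union> B' \<union> C')"
proof -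
  obtain fa fb fc where f: "bij_betw fa A A'" "bij_betw fb B B'" "bij_betw fc C C'"
    using assms(1-9) finite_same_card_bij by metis
  define f where "f = (\<lambda>v. if v \<in> A then fa v else if v \<in> B then fb v else fc v)"
  have "bij_betw f A A'" using f(1) by (rule bij_betw_cong[THEN iffD1, rotated]) (simp add: f_def)
  moreover have "bij_betw f B B'" using f(2)
    by (rule bij_betw_cong[THEN iffD1, rotated]) (use assms(10) in \<open>auto simp: f_def\<close>)
  moreover have "bij_betw f C C'" using f(3)
    by (rule bij_betw_cong[THEN iffD1, rotated]) (use assms(11,12) in \<open>auto simp: f_def\<close>)
  moreover have "bij_betw f (A \<union> B \<union> C) (A' \<union> B' \<union> C')"
    using calculation assms(13-15) by (intro bij_betw_combine) auto
  ultimately show ?thesis using that by blast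
qed

lemma image_triples:
  assumes "inj_on f V" "e \<subseteq> V" "card e = 3" "f ` e \<subseteq> S"
  shows "f ` e \<in> triples S"
  using assms card_image[OF inj_on_subset[OF assms(1,2)]] by (simp add: triples_def)

section \<open>The comet: its size, its \<open>P\<close>-freeness, and why it fits in neither
  earlier extremal graph\<close>

lemma card_comet: "4 \<le> n \<Longrightarrow> card (comet_E n) = 4 + ((n - 4) choose 2)"
proof -
  assume n: "4 \<le> n"
  let ?Q = "{q. q \<subseteq> {4..<n} \<and> card q = 2}"
  have pages: "{{0,u,v} | u v. u \<in> {4..<n} \<and> v \<in> {4..<n} \<and> u \<noteq> v} = insert 0 ` ?Q"
  proof
    show "insert 0 ` ?Q \<subseteq> {{0,u,v} | u v. u \<in> {4..<n} \<and> v \<in> {4..<n} \<and> u \<noteq> v}"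
    proof (rule image_subsetI)
      fix q assume "q \<in> ?Q"
      then obtain u v where "q = {u,v}" "u \<noteq> v" "u \<in> {4..<n}" "v \<in> {4..<n}" by (auto simp: card_2_iff)
      then show "insert 0 q \<in> {{0,u,v} | u v. u \<in> {4..<n} \<and> v \<in> {4..<n} \<and> u \<noteq> v}" by blast
    qed
  next
    show "{{0,u,v} | u v. u \<in> {4..<n} \<and> v \<in> {4..<n} \<and> u \<noteq> v} \<subseteq> insert 0 ` ?Q"
    proof
      fix e assume "e \<in> {{0,u,v} | u v. u \<in> {4..<n} \<and> v \<in> {4..<n} \<and> u \<noteq> v}"
      then obtain u v where uv: "e = insert 0 {u,v}" "u \<in> {4..<n}" "v \<in> {4..<n}" "u \<noteq> v" by blast
      then have "{u,v} \<in> ?Q" by simp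
      with uv(1) show "e \<in> insert 0 ` ?Q" by blast
    qed
  qed
  have inj: "inj_on (insert 0) ?Q"
  proof (rule inj_onI)
    fix p q :: "nat set" assume "p \<in> ?Q" "q \<in> ?Q" "insert 0 p = insert 0 q"
    moreover from this have "0 \<notin> p" "0 \<notin> q" by auto
    ultimately show "p = q" by (simp add: insert_ident)
  qed
  have "triples {0..<4} \<inter> insert 0 ` ?Q = {}"
  proof -
    have "\<not> insert 0 q \<subseteq> {0..<4}" if "q \<in> ?Q" for q
    proof -
      from that have "q \<noteq> {}" "q \<subseteq> {4..<n}" by auto
      then show ?thesis by fastforce
    qed
    then show ?thesis by (auto simp: triples_def)
  qed
  then have "card (comet_E n) = card (triples {0..<4::nat}) + card (insert 0 ` ?Q)"
    unfolding comet_E_def pages by (intro card_Un_disjoint) (auto simp: finite_triples)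
  also have "\<dots> = (4 choose 3) + ((n - 4) choose 2)"
    using card_image[OF inj] n_subsets[of "{4..<n}" 2] card_triples[of "{0..<4::nat}"] by simp
  finally show ?thesis by (simp add: numeral_eq_Suc)
qed

lemma comet_page: "u \<in> {4..<n} \<Longrightarrow> v \<in> {4..<n} \<Longrightarrow> u \<noteq> v \<Longrightarrow> {0,u,v} \<in> comet_E n"
  unfolding comet_E_def by blast

lemma comet_head:
  assumes "A \<in> comet_E n" "0 \<notin> A"
  shows "A = {1,2,3}"
proof -
  have "A \<subseteq> {0..<4}" "card A = 3" using assms by (auto simp: comet_E_def triples_def)
  moreover have "{0..<4::nat} = {0,1,2,3}" by auto
  ultimately have "A \<subseteq> {1,2,3}" "card A = card {1,2,3::nat}" using assms(2) by auto
  then show ?thesis by (intro card_subset_eq) auto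
qed

text \<open>The only edge avoiding the centre is \<open>{1,2,3}\<close>. A comet edge meeting it is
  a triple of the same 4-set, so the two share two vertices.\<close>

lemma comet_no_attach:
  assumes "A \<in> comet_E n" "B \<in> comet_E n" "A \<inter> B = {c}" "0 \<notin> A"
  shows False
proof -
  have A: "A = {1,2,3}" using comet_head assms by blast
  have c: "c \<in> {1,2,3}" "c \<in> B" using A assms(3) by blast+
  then have B: "B \<subseteq> {0..<4}" "card B = 3" using assms(2) by (auto simp: comet_E_def triples_def)
  moreover have "{0..<4::nat} = {0,1,2,3}" by auto
  ultimately have "B \<subseteq> {0,c}" using A assms(3) by auto
  then have "card B \<le> card {0,c}" by (intro card_mono) auto
  also have "\<dots> \<le> 2" by (simp add: card_insert_if)
  finally show False using B(2) by simp
qed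

text \<open>The end edges of a path are disjoint, so one of them avoids the centre, yet it meets the
  middle edge in a single vertex.\<close>

lemma comet_P_free: "\<not> contains_P (comet_E n)"
proof
  assume "contains_P (comet_E n)"
  then obtain a b c d e f g where d: "distinct [a,b,c,d,e,f,g]"
    and E: "{a,b,c} \<in> comet_E n" "{c,d,e} \<in> comet_E n" "{e,f,g} \<in> comet_E n"
    unfolding contains_P_def by (elim exE conjE)
  have i: "{a,b,c} \<inter> {c,d,e} = {c}" "{e,f,g} \<inter> {c,d,e} = {e}" "{a,b,c} \<inter> {e,f,g} = {}"
    using d by auto
  then have "0 \<notin> {a,b,c} \<or> 0 \<notin> {e,f,g}" by (metis disjoint_iff)
  then show False using comet_no_attach[OF E(1,2) i(1)] comet_no_attach[OF E(3,2) i(2)] by argo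
qed

lemma comet_graph: "4 \<le> n \<Longrightarrow> is_3graph {0..<n} (comet_E n)"
  by (auto simp: is_3graph_def comet_E_def triples_def)

text \<open>The comet has the disjoint edges \<open>{1,2,3}\<close> and \<open>{0,4,5}\<close>,
  while any two star edges share the centre.\<close>

lemma comet_not_in_star: "\<not> sub_iso {0..<12} (comet_E 12) {0..<12} (star_E 12)"
proof
  assume "sub_iso {0..<12} (comet_E 12) {0..<12::nat} (star_E 12)"
  then obtain f where f: "inj_on f {0..<12}" "\<And>e. e \<in> comet_E 12 \<Longrightarrow> f ` e \<in> star_E 12"
    by (auto simp: sub_iso_def)
  have "{1,2,3} \<in> comet_E 12" by (simp add: comet_E_def triples_def)
  moreover have "{0,4,5} \<in> comet_E 12" by (rule comet_page) auto
  ultimately have "0 \<in> f ` {1,2,3}" "0 \<in> f ` {0,4,5}" using f(2) by (force simp: star_E_def)+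
  then obtain u v where uv: "u \<in> {1,2,3}" "v \<in> {0,4,5}" "f u = f v" by (metis imageE)
  have "u = v" by (rule inj_onD[OF f(1) uv(3)]) (use uv(1,2) in auto)
  then show False using uv by auto
qed

text \<open>Each of the vertices 4 to 11 shares an edge with 0, so these nine vertices would all
  land in the same copy of \<open>K_6\<close>.\<close>

lemma comet_not_in_K6K6: "\<not> sub_iso {0..<12} (comet_E 12) {0..<12} K6K6_E"
proof
  assume "sub_iso {0..<12} (comet_E 12) {0..<12::nat} K6K6_E"
  then obtain f where f: "inj_on f {0..<12}" "\<And>e. e \<in> comet_E 12 \<Longrightarrow> f ` e \<in> K6K6_E"
    by (auto simp: sub_iso_def)
  have side: "f 0 < 6 \<and> f u < 6 \<or> f 0 \<in> {6..<12} \<and> f u \<in> {6..<12}" if u: "u \<in> insert 0 {4..<12}" for u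
  proof -
    obtain v w where "v \<in> {4..<12}" "w \<in> {4..<12}" "v \<noteq> w" "u \<in> {0,v,w}"
    proof (cases "u = 4 \<or> u = 0")
      case True
      then show ?thesis using that[of 4 5] by auto
    next
      case False
      then show ?thesis using that[of u 4] u by auto
    qed
    moreover from this have "{0,v,w} \<in> comet_E 12" by (intro comet_page)
    from f(2)[OF this] have "f ` {0,v,w} \<subseteq> {0..<6} \<or> f ` {0,v,w} \<subseteq> {6..<12}"
      by (auto simp: K6K6_E_def triples_def)
    ultimately show ?thesis by auto
  qed
  have "f ` insert 0 {4..<12} \<subseteq> {0..<6} \<or> f ` insert 0 {4..<12} \<subseteq> {6..<12}"
  proof (cases "f 0 < 6")
    case True
    then have "f u \<in> {0..<6}" if "u \<in> insert 0 {4..<12}" for u using side[OF that] by auto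
    then show ?thesis by blast
  next
    case False
    then have "f u \<in> {6..<12}" if "u \<in> insert 0 {4..<12}" for u using side[OF that] by auto
    then show ?thesis by blast
  qed
  then have "card (f ` insert 0 {4..<12}) \<le> 6"
    using card_mono[of "{0..<6}" "f ` insert 0 {4..<12}"] card_mono[of "{6..<12}" "f ` insert 0 {4..<12}"] by auto
  moreover have "card (f ` insert 0 {4..<12}) = card (insert 0 {4..<12::nat})"
    by (intro card_image inj_on_subset[OF f(1)]) auto
  ultimately show False by simp
qed

section \<open>Embedding a dense \<open>P\<close>-free 3-graph into the three target graphs\<close>

context P_free_3graph
begin

lemma star_embedding:
  assumes "card V = 12" "x \<in> V" "\<And>e. e \<in> E \<Longrightarrow> x \<in> e"
  shows "sub_iso V E {0..<12} (star_E 12)"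
proof -
  have "card (V - {x}) = card {1..<12::nat}" using assms by simp
  then obtain f where f: "bij_betw f {x} {0::nat}" "bij_betw f ({x} \<union> {} \<union> (V - {x})) ({0} \<union> {} \<union> {1..<12::nat})"
    using three_part_bij[of "{x}" "{}" "V - {x}" "{0::nat}" "{}" "{1..<12::nat}"] fin_V by auto
  have eq: "{x} \<union> {} \<union> (V - {x}) = V" "{0} \<union> {} \<union> {1..<12::nat} = {0..<12}" using assms(2) by auto
  have b: "bij_betw f V {0..<12}" using f(2) unfolding eq .
  have x0: "f x = 0" using f(1) by (simp add: bij_betw_def)
  have "f ` e \<in> star_E 12" if e: "e \<in> E" for e
  proof -
    have "f ` e \<subseteq> {0..<12}" using b edge_sub[OF e] by (auto simp: bij_betw_def)
    then have "f ` e \<in> triples {0..<12}"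
      using image_triples[OF _ edge_sub[OF e] edge_card[OF e]] b by (auto simp: bij_betw_def)
    moreover have "0 \<in> f ` e" using x0 assms(3)[OF e] by force
    ultimately show ?thesis by (simp add: star_E_def)
  qed
  then show ?thesis using b unfolding sub_iso_def bij_betw_def by blast
qed

lemma K6K6_embedding:
  assumes "card V = 12" "U \<subseteq> V" "card U = 6" "\<And>e. e \<in> E \<Longrightarrow> e \<subseteq> U \<or> e \<subseteq> V - U"
  shows "sub_iso V E {0..<12} K6K6_E"
proof -
  have fU: "finite U" using assms(2) fin_V finite_subset by blast
  have "card (V - U) = card {6..<12::nat}" using assms fU by (simp add: card_Diff_subset)
  then obtain f where f: "bij_betw f U {0..<6::nat}" "bij_betw f (V - U) {6..<12}"
      "bij_betw f (U \<union> (V - U) \<union> {}) ({0..<6} \<union> {6..<12::nat} \<union> {})"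
    using three_part_bij[of U "V - U" "{}" "{0..<6::nat}" "{6..<12::nat}" "{}"] fin_V fU assms(3) by auto
  have eq: "U \<union> (V - U) \<union> {} = V" "{0..<6} \<union> {6..<12::nat} \<union> {} = {0..<12}" using assms(2) by auto
  have b: "bij_betw f V {0..<12}" using f(3) unfolding eq .
  have "f ` e \<in> K6K6_E" if e: "e \<in> E" for e
  proof -
    have "f ` e \<subseteq> {0..<6} \<or> f ` e \<subseteq> {6..<12}"
      using assms(4)[OF e] f(1,2) unfolding bij_betw_def by blast
    then show ?thesis
      using image_triples[OF _ edge_sub[OF e] edge_card[OF e]] b by (auto simp: bij_betw_def K6K6_E_def)
  qed
  then show ?thesis using b unfolding sub_iso_def bij_betw_def by blast
qed

text \<open>A bijection respecting centre, head and remainder sends \<open>E\<close> injectively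
  into the 32 comet edges. As \<open>E\<close> has at least 32 edges, the image is the whole
  comet.\<close>

lemma comet_iso:
  assumes V: "card V = 12" and xW: "x \<in> V" "W \<subseteq> V - {x}" "card W = 3"
    and E: "\<And>e. e \<in> E \<Longrightarrow> e \<subseteq> insert x W \<or> x \<in> e \<and> e - {x} \<subseteq> V - {x} - W"
    and c: "32 \<le> card E"
  shows "card E = 32 \<and> iso3 V E {0..<12} (comet_E 12)"
proof -
  have fW: "finite W" using xW(2) fin_V finite_subset by blast
  have cR: "card (V - {x} - W) = card {4..<12::nat}" using assms fW by (simp add: card_Diff_subset)
  obtain f where f: "bij_betw f {x} {0::nat}" "bij_betw f W {1..<4}" "bij_betw f (V - {x} - W) {4..<12}"
      "bij_betw f ({x} \<union> W \<union> (V - {x} - W)) ({0} \<union> {1..<4} \<union> {4..<12::nat})"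
  proof (rule three_part_bij[of "{x}" W "V - {x} - W" "{0::nat}" "{1..<4::nat}" "{4..<12::nat}"])
  qed (use fin_V fW xW(2,3) cR in auto)
  have eq: "{x} \<union> W \<union> (V - {x} - W) = V" "{0} \<union> {1..<4} \<union> {4..<12::nat} = {0..<12}" using xW by auto
  have b: "bij_betw f V {0..<12}" using f(4) unfolding eq .
  have x0: "f x = 0" using f(1) by (simp add: bij_betw_def)
  have inj: "inj_on f V" using b by (simp add: bij_betw_def)
  have sub: "f ` e \<in> comet_E 12" if e: "e \<in> E" for e
  proof (cases "e \<subseteq> insert x W")
    case True
    have "f ` insert x W \<subseteq> {0..<4}" using x0 f(2) by (auto simp: bij_betw_def)
    then have "f ` e \<subseteq> {0..<4}" using True by blast
    then have "f ` e \<in> triples {0..<4}" by (rule image_triples[OF inj edge_sub[OF e] edge_card[OF e]])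
    then show ?thesis by (simp add: comet_E_def)
  next
    case False
    then have x: "x \<in> e" "e - {x} \<subseteq> V - {x} - W" using E[OF e] by auto
    obtain u v where uv: "e = {u,v,x}" "u \<noteq> v" "u \<noteq> x" "v \<noteq> x"
      using card3_with[OF edge_card[OF e] x(1)] .
    have R: "u \<in> V - {x} - W" "v \<in> V - {x} - W" using x(2) uv by auto
    then have "f u \<in> {4..<12}" "f v \<in> {4..<12}" using f(3) unfolding bij_betw_def by blast+
    moreover have "f u \<noteq> f v" using inj_onD[OF inj, of u v] R uv(2) by blast
    moreover have "f ` e = {0, f u, f v}" using uv(1) x0 by auto
    ultimately show ?thesis using comet_page by simp
  qed
  have injE: "inj_on ((`) f) E"
  proof (rule inj_onI)
    fix e e' assume "e \<in> E" "e' \<in> E" "f ` e = f ` e'"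
    then show "e = e'" using inj_on_image_eq_iff[OF inj, of e e'] edge_sub by blast
  qed
  have cc: "card (comet_E 12) = 32" using card_comet[of 12] by (simp add: choose_two)
  then have fin: "finite (comet_E 12)" using card.infinite by fastforce
  have sub': "(`) f ` E \<subseteq> comet_E 12" using sub by blast
  have "card ((`) f ` E) = card E" by (rule card_image[OF injE])
  moreover have "card ((`) f ` E) \<le> 32" using card_mono[OF fin sub'] cc by simp
  ultimately have c32: "card E = 32" "card ((`) f ` E) = card (comet_E 12)" using c cc by linarith+
  have img: "(`) f ` E = comet_E 12" by (rule card_subset_eq[OF fin sub' c32(2)])
  have "e \<in> E \<longleftrightarrow> f ` e \<in> comet_E 12" if "e \<subseteq> V" for e
  proof
    assume "f ` e \<in> comet_E 12"
    then obtain e' where e': "e' \<in> E" "f ` e = f ` e'" unfolding img[symmetric] by blast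
    then have "e = e'" using inj_on_image_eq_iff[OF inj that edge_sub] by blast
    then show "e \<in> E" using e' by simp
  qed (rule sub)
  then show ?thesis using b c32(1) unfolding iso3_def by blast
qed

lemma comet_extremal:
  assumes V: "card V = 12" and star: "\<not> sub_iso V E {0..<12} (star_E 12)"
    and K6: "\<not> sub_iso V E {0..<12} K6K6_E"
  shows "card E \<le> 32 \<and> (card E = 32 \<longrightarrow> iso3 V E {0..<12} (comet_E 12))"
proof (cases "32 \<le> card E")
  case True
  show ?thesis
  proof (rule structure_of_dense[OF V True])
    show ?thesis if "x \<in> V" "\<And>e. e \<in> E \<Longrightarrow> x \<in> e" for x
      using star star_embedding[OF V that] by blast
    show ?thesis if "U \<subseteq> V" "card U = 6" "\<And>e. e \<in> E \<Longrightarrow> e \<subseteq> U \<or> e \<subseteq> V - U" for U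
      using K6 K6K6_embedding[OF V that] by blast
    show ?thesis if "x \<in> V" "W \<subseteq> V - {x}" "card W = 3"
      "\<And>e. e \<in> E \<Longrightarrow> e \<subseteq> insert x W \<or> x \<in> e \<and> e - {x} \<subseteq> V - {x} - W" for x W
      using comet_iso[OF V that True] by simp
  qed
qed simp

end

theorem mainTheorem3:
  shows "(is_3graph {0..<12::nat} (comet_E 12) \<and> \<not> contains_P (comet_E 12)
          \<and> \<not> sub_iso {0..<12::nat} (comet_E 12) {0..<12::nat} (star_E 12)
          \<and> \<not> sub_iso {0..<12::nat} (comet_E 12) {0..<12::nat} K6K6_E
          \<and> card (comet_E 12) = 32)
      \<and> (\<forall>(V::'a set) E. is_3graph V E \<and> card V = 12 \<and> \<not> contains_P E
           \<and> \<not> sub_iso V E {0..<12::nat} (star_E 12)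
           \<and> \<not> sub_iso V E {0..<12::nat} K6K6_E
           \<longrightarrow> card E \<le> 32 \<and> (card E = 32 \<longrightarrow> iso3 V E {0..<12::nat} (comet_E 12)))"
proof (intro conjI allI impI)
  show "is_3graph {0..<12::nat} (comet_E 12)" by (rule comet_graph) simp
  show "\<not> contains_P (comet_E 12)" by (rule comet_P_free)
  show "\<not> sub_iso {0..<12} (comet_E 12) {0..<12::nat} (star_E 12)" by (rule comet_not_in_star)
  show "\<not> sub_iso {0..<12} (comet_E 12) {0..<12::nat} K6K6_E" by (rule comet_not_in_K6K6)
  show "card (comet_E 12) = 32" using card_comet[of 12] by (simp add: choose_two)
next
  fix V :: "'a set" and E
  assume h: "is_3graph V E \<and> card V = 12 \<and> \<not> contains_P E
           \<and> \<not> sub_iso V E {0..<12::nat} (star_E 12) \<and> \<not> sub_iso V E {0..<12::nat} K6K6_E"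
  then interpret P_free_3graph V E by unfold_locales auto
  from h show "card E \<le> 32" "card E = 32 \<Longrightarrow> iso3 V E {0..<12::nat} (comet_E 12)"
    using comet_extremal by blast+
qed

end
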